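(* Let $m\ge 2$ and let $\overline{\mathcal T}$ be the asymptotic fringe tree of the random extended $m$-ary search tree. The number $K$ of keys in $\overline{\mathcal T}$ has the distribution $$\mathbb P(K=k)=\frac{1}{(k+1)(k+2)},\qquad k\ge 0 .$$ Furthermore, $\overline{\mathcal T}$ can be described as an extended $m$-ary search tree with a random number $K$ of keys, where $K$ has this distribution; that is, for every $k\ge0$, conditioned on $K=k$, $\overline{\mathcal T}$ has the same distribution as the random extended $m$-ary search tree $T_k$ with $k$ keys.
   Context: Extended $m$-ary search tree: each node holds up to $m-1$ keys (distinct reals). Start with an empty root. The first $m-1$ keys are stored in the root; when the $(m-1)$-th key is placed in the root, $m$ new empty nodes are added as its children $1,\dots,m$. The $m-1$ keys divide $\mathbb R$ into intervals $J_1,\dots,J_m$; each further key lying in $J_i$ is passed to child $i$, where the same rule is applied recursively. Nodes without keys are called external and are kept in the extended tree. Each node is labelled by its number of keys in $\{0,\dots,m-1\}$, and children carry their positions $1,\dots,m$. The random extended $m$-ary search tree $T_n$ is obtained from $n$ i.i.d. keys with a continuous distribution (equivalently, a uniformly random permutation of $\{1,\dots,n\}$). Branching process: consider the continuous-time branching process started with one individual at time 0 where all individuals have independent, identically distributed life histories: an individual is born as a node with no keys; it acquires $m-1$ keys after successive independent waiting times $Y_1,\dots,Y_{m-1}$, $Y_i\sim\mathrm{Exp}(i)$ (rate $i$); at the moment it gets its $(m-1)$-th key it immediately gets $m$ children (in positions $1,\dots,m$). Let $\mathcal T_t$ be the family tree at time $t$, with nodes labelled by their current number of keys. The asymptotic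 fringe tree is $\overline{\mathcal T}:=\mathcal T_{\overline\tau}$, where $\overline\tau\sim\mathrm{Exp}(1)$ is independent of the branching process. (It is the limit in distribution, as $n\to\infty$, of the subtree of $T_n$ rooted at a uniformly random node.) *)

theory Defs
  imports "HOL-Probability.Probability"
begin

text \<open>
  A labelled tree is a partial map from addresses to labels: the address of a node is the list of
  child positions on the path from the root to it, so the root is the empty list. The domain is
  the set of nodes, and the label of a node is its number of keys. Infinite trees are allowed.
\<close>

type_synonym ltree = "nat list \<Rightarrow> nat option"

definition tree_space :: "ltree measure" where
  "tree_space = (\<Pi>\<^sub>M u\<in>UNIV. count_space UNIV)"

definition num_keys :: "ltree \<Rightarrow> ennreal" where
  "num_keys T = (\<Sum>\<^sub>\<infinity>u\<in>dom T. of_nat (the (T u)))"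

text \<open>
  The extended \<open>m\<close>-ary search tree of a sequence of keys. If the keys in the root are
  \<open>K\<^sub>1 < \<dots> < K\<^sub>m\<^sub>-\<^sub>1\<close>, then a real \<open>x\<close> that is not one of them lies in the interval \<open>J\<^sub>i\<close> iff
  exactly \<open>i - 1\<close> of them are less than \<open>x\<close>. For repeated keys, which have probability zero
  below, the value is irrelevant.
\<close>

primrec search_tree :: "nat \<Rightarrow> real list \<Rightarrow> ltree" where
  "search_tree m xs [] = Some (min (length xs) (m - 1))"
| "search_tree m xs (i # u) =
     (if m - 1 \<le> length xs \<and> i \<in> {1..m} then
        search_tree m
          (filter (\<lambda>x. card {y \<in> set (take (m - 1) xs). y < x} = i - 1) (drop (m - 1) xs)) u
      else None)"

definition random_search_tree :: "nat \<Rightarrow> real measure \<Rightarrow> nat \<Rightarrow> ltree measure" where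
  "random_search_tree m D n =
     distr (\<Pi>\<^sub>M j\<in>{..<n}. D) tree_space (\<lambda>x. search_tree m (map x [0..<n]))"

text \<open>
  The branching process for one realisation \<open>y\<close> of the waiting times: \<open>y u i\<close> is the waiting time
  of the individual \<open>u\<close> for its \<open>i\<close>-th key, \<open>1 \<le> i \<le> m - 1\<close>. The \<open>m\<close> children of an individual are
  born when it gets its key number \<open>m - 1\<close>, so the birth time of \<open>u\<close> is the sum of
  all waiting times of its proper ancestors.
\<close>

definition birth_time :: "nat \<Rightarrow> (nat list \<Rightarrow> nat \<Rightarrow> real) \<Rightarrow> nat list \<Rightarrow> real" where
  "birth_time m y u = (\<Sum>j<length u. \<Sum>i=1..m-1. y (take j u) i)"

definition keys_at :: "nat \<Rightarrow> (nat list \<Rightarrow> nat \<Rightarrow> real) \<Rightarrow> real \<Rightarrow> nat list \<Rightarrow> nat" where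
  "keys_at m y t u = card {i \<in> {1..m-1}. birth_time m y u + (\<Sum>j=1..i. y u j) \<le> t}"

definition family_tree :: "nat \<Rightarrow> (nat list \<Rightarrow> nat \<Rightarrow> real) \<Rightarrow> real \<Rightarrow> ltree" where
  "family_tree m y t u =
     (if u \<in> lists {1..m} \<and> birth_time m y u \<le> t then Some (keys_at m y t u) else None)"

text \<open>
  The life histories (waiting times) of all potential individuals, together with the time \<open>\<tau>\<close> at
  which the process is stopped. The index \<open>None\<close> stands for \<open>\<tau>\<close>, so that all the waiting times
  and \<open>\<tau>\<close> are jointly independent.
\<close>

definition stopped_branching_process ::
  "'a measure \<Rightarrow> nat \<Rightarrow> (nat list \<Rightarrow> nat \<Rightarrow> 'a \<Rightarrow> real) \<Rightarrow> ('a \<Rightarrow> real) \<Rightarrow> bool" where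
  "stopped_branching_process M m Y \<tau> \<longleftrightarrow>
     prob_space M \<and>
     prob_space.indep_vars M (\<lambda>_. borel)
       (\<lambda>a. case a of None \<Rightarrow> \<tau> | Some (u, i) \<Rightarrow> Y u i)
       (insert None (Some ` (lists {1..m} \<times> {1..m-1}))) \<and>
     (\<forall>u\<in>lists {1..m}. \<forall>i\<in>{1..m-1}.
        distributed M lborel (Y u i) (exponential_density (real i))) \<and>
     distributed M lborel \<tau> (exponential_density 1)"

definition fringe_tree ::
  "nat \<Rightarrow> (nat list \<Rightarrow> nat \<Rightarrow> 'a \<Rightarrow> real) \<Rightarrow> ('a \<Rightarrow> real) \<Rightarrow> 'a \<Rightarrow> ltree" where
  "fringe_tree m Y \<tau> \<omega> = family_tree m (\<lambda>u i. Y u i \<omega>) (\<tau> \<omega>)"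

text \<open>
  The maps whose distributions are compared are measurable, so the pushforward measures are genuine
  distributions.
\<close>

lemma filter_measurable_count_space:
  fixes js :: "nat list"
  assumes "\<And>j. j \<in> set js \<Longrightarrow> Measurable.pred N (\<lambda>x. P x j)"
  shows "(\<lambda>x. filter (P x) js) \<in> measurable N (count_space UNIV)"
  using assms
proof (induction js)
  case Nil
  then show ?case by simp
next
  case (Cons j js)
  have [measurable]: "Measurable.pred N (\<lambda>x. P x j)"
    "(\<lambda>x. filter (P x) js) \<in> measurable N (count_space UNIV)"
    using Cons by auto
  show ?case by simp
qed

lemma card_less_measurable:
  fixes js :: "nat list" and f :: "'a \<Rightarrow> nat \<Rightarrow> real"
  assumes "\<And>j. j \<in> set js \<Longrightarrow> (\<lambda>x. f x j) \<in> borel_measurable N"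
    and a [measurable]: "a \<in> borel_measurable N"
  shows "(\<lambda>x. card {y \<in> set (map (f x) js). y < a x}) \<in> measurable N (count_space UNIV)"
  using assms(1)
proof (induction js)
  case Nil
  then show ?case by simp
next
  case (Cons k js)
  have [measurable]: "(\<lambda>x. f x k) \<in> borel_measurable N" using Cons.prems by auto
  have [measurable]: "(\<lambda>x. card {y \<in> set (map (f x) js). y < a x}) \<in> measurable N (count_space UNIV)"
    by (intro Cons) (use Cons.prems in auto)
  have [measurable]: "Measurable.pred N (\<lambda>x. \<forall>l\<in>set js. f x l \<noteq> f x k)"
  proof (rule pred_intros_finite)
    fix l assume "l \<in> set js"
    then have [measurable]: "(\<lambda>x. f x l) \<in> borel_measurable N" using Cons.prems by auto
    show "Measurable.pred N (\<lambda>x. f x l \<noteq> f x k)" by measurable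
  qed simp
  have eq: "card {y \<in> set (map (f x) (k # js)). y < a x} =
      (if f x k < a x \<and> (\<forall>l\<in>set js. f x l \<noteq> f x k) then 1 else 0) +
      card {y \<in> set (map (f x) js). y < a x}" for x
  proof -
    have "{y \<in> set (map (f x) (k # js)). y < a x} =
        (if f x k < a x then {f x k} else {}) \<union> {y \<in> set (map (f x) js). y < a x}"
      by auto
    moreover have "f x k \<in> {y \<in> set (map (f x) js). y < a x} \<longleftrightarrow>
        f x k < a x \<and> \<not> (\<forall>l\<in>set js. f x l \<noteq> f x k)"
      by (auto simp: image_iff) metis
    ultimately show ?thesis by (auto simp: card_insert_if)
  qed
  show ?case unfolding eq by measurable
qed

lemma search_tree_address_measurable:
  fixes js :: "nat list"
  assumes D: "sets D = sets borel" and "set js \<subseteq> I"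
  shows "(\<lambda>x. search_tree m (map x js) u) \<in> measurable (\<Pi>\<^sub>M j\<in>I. D) (count_space UNIV)"
  using assms(2)
proof (induction u arbitrary: js)
  case Nil
  then show ?case by simp
next
  case (Cons i u)
  let ?N = "\<Pi>\<^sub>M j\<in>I. D"
  let ?P = "\<lambda>(x :: nat \<Rightarrow> real) a.
    card {y \<in> set (map x (take (m - 1) js)). y < a} = i - 1"
  let ?f = "\<lambda>x. filter (\<lambda>j. ?P x (x j)) (drop (m - 1) js)"
  have comp: "(\<lambda>x. x j) \<in> borel_measurable ?N" if "j \<in> set js" for j
  proof -
    have "(\<lambda>x. x j) \<in> measurable ?N D"
      using that Cons.prems by (intro measurable_component_singleton) auto
    then show ?thesis by (simp add: measurable_cong_sets[OF refl D])
  qed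
  have f [measurable]: "?f \<in> measurable ?N (count_space UNIV)"
  proof (rule filter_measurable_count_space)
    fix j assume "j \<in> set (drop (m - 1) js)"
    then have [measurable]: "(\<lambda>x. card {y \<in> set (map x (take (m - 1) js)). y < x j})
        \<in> measurable ?N (count_space UNIV)"
      by (intro card_less_measurable comp) (auto dest: in_set_takeD in_set_dropD)
    show "Measurable.pred ?N (\<lambda>x. ?P x (x j))" by measurable
  qed
  have "(\<lambda>x. search_tree m (map x (filter (\<lambda>j. j \<in> I) (?f x))) u)
      \<in> measurable ?N (count_space UNIV)"
  proof (rule measurable_compose_countable[where g = ?f])
    show "(\<lambda>x. search_tree m (map x (filter (\<lambda>j. j \<in> I) ks)) u) \<in> measurable ?N (count_space UNIV)"
      for ks
      by (rule Cons.IH) auto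
  qed (rule f)
  moreover have "filter (\<lambda>j. j \<in> I) (?f x) = ?f x" for x
    using Cons.prems set_drop_subset[of "m - 1" js] by (intro filter_True) auto
  ultimately have "(\<lambda>x. search_tree m (map x (?f x)) u) \<in> measurable ?N (count_space UNIV)"
    by (simp only:)
  moreover have eq: "search_tree m (map x js) (i # u) =
      (if m - 1 \<le> length js \<and> i \<in> {1..m} then search_tree m (map x (?f x)) u else None)" for x
    unfolding search_tree.simps(2) filter_map drop_map take_map o_def length_map ..
  ultimately show ?case
    unfolding eq by (cases "m - 1 \<le> length js \<and> i \<in> {1..m}") (simp_all only: if_True if_False simp_thms, simp)
qed

lemma search_tree_measurable:
  assumes "real_distribution D"
  shows "(\<lambda>x. search_tree m (map x [0..<n])) \<in> measurable (\<Pi>\<^sub>M j\<in>{..<n}. D) tree_space"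
proof -
  interpret real_distribution D by fact
  show ?thesis
    unfolding tree_space_def
    by (rule measurable_PiM_single') (auto intro!: search_tree_address_measurable)
qed

lemma fringe_tree_measurable:
  assumes "stopped_branching_process M m Y \<tau>"
  shows "fringe_tree m Y \<tau> \<in> measurable M tree_space"
proof -
  have Y: "Y u i \<in> borel_measurable M" if "u \<in> lists {1..m}" "i \<in> {1..m-1}" for u i
    using assms that distributed_measurable[of M lborel "Y u i"]
    by (fastforce simp: stopped_branching_process_def)
  have [measurable]: "\<tau> \<in> borel_measurable M"
    using assms distributed_measurable[of M lborel \<tau>]
    by (fastforce simp: stopped_branching_process_def)
  have *: "(\<lambda>\<omega>. fringe_tree m Y \<tau> \<omega> u) \<in> measurable M (count_space UNIV)" for u
  proof (cases "u \<in> lists {1..m}")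
    case False
    then show ?thesis unfolding fringe_tree_def family_tree_def by simp
  next
    case True
    have take: "take j u \<in> lists {1..m}" for j
      using True by (auto dest: in_set_takeD)
    have [measurable]: "(\<lambda>\<omega>. birth_time m (\<lambda>u i. Y u i \<omega>) u) \<in> borel_measurable M"
      unfolding birth_time_def by (intro borel_measurable_sum Y take)
    have [measurable]: "(\<lambda>\<omega>. keys_at m (\<lambda>u i. Y u i \<omega>) (\<tau> \<omega>) u) \<in> measurable M (count_space UNIV)"
    proof -
      have "Measurable.pred M (\<lambda>\<omega>. birth_time m (\<lambda>u i. Y u i \<omega>) u + (\<Sum>j=1..i. Y u j \<omega>) \<le> \<tau> \<omega>)"
        if "i \<in> {1..m-1}" for i
      proof -
        have [measurable]: "(\<lambda>\<omega>. \<Sum>j=1..i. Y u j \<omega>) \<in> borel_measurable M"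
          using that True by (intro borel_measurable_sum Y) auto
        show ?thesis by measurable
      qed
      then have [measurable]: "(\<lambda>\<omega>. filter (\<lambda>i. birth_time m (\<lambda>u i. Y u i \<omega>) u
            + (\<Sum>j=1..i. Y u j \<omega>) \<le> \<tau> \<omega>) [1..<Suc (m-1)]) \<in> measurable M (count_space UNIV)"
        by (intro filter_measurable_count_space) auto
      have eq: "keys_at m y t u = length (filter (\<lambda>i. birth_time m y u + (\<Sum>j=1..i. y u j) \<le> t)
          [1..<Suc (m-1)])" for y t
        unfolding keys_at_def
        by (subst distinct_card[symmetric]) (auto intro!: arg_cong[where f = card])
      show ?thesis unfolding eq by measurable
    qed
    show ?thesis
      using True unfolding fringe_tree_def family_tree_def by simp
  qed
  show ?thesis
    unfolding tree_space_def by (rule measurable_PiM_single') (use * in auto)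
qed

end

theory Submission
  imports Defs
begin

text \<open>
  The root of the family tree splits at time \<open>S\<close> with density
  \<open>(m - 1) exp(-s) (1 - exp(-s))\<^sup>m\<^sup>-\<^sup>2\<close>, after which its \<open>m\<close> subtrees are independent copies
  of the process. Let \<open>c(T)\<close> be the probability that the random search tree with as many keys as \<open>T\<close>
  equals \<open>T\<close>. The root keys of a uniformly random permutation of \<open>k\<close> keys are a uniformly random set of
  \<open>m - 1\<close> separators, and the remaining keys form independent uniformly random permutations, so
  \<open>c(T) = c(T\<^sub>1) \<dots> c(T\<^sub>m) / (k choose m - 1)\<close> for subtrees \<open>T\<^sub>1, \<dots>, T\<^sub>m\<close> of \<open>T\<close>. With a Beta integral
  over \<open>s\<close>, induction on \<open>k\<close> gives \<open>P(\<T>\<^sub>t = T) = c(T) exp(-t) (1 - exp(-t))\<^sup>k\<close>. Integration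
  over the exponential time yields \<open>c(T) / ((k + 1) (k + 2))\<close>. These values already sum to \<open>1\<close> over
  all search trees, so no other tree has positive probability, and both claims follow.
\<close>

subsection \<open>Orders of classes in a permutation\<close>

text \<open>Why time and shape separate: a node with \<open>j < m - 1\<close> keys waits an
  exponential time of rate \<open>j + 1\<close>, its number of gaps, and a full node has handed its
  gaps over to its children. A tree with \<open>k\<close> keys therefore grows at total rate
  \<open>k + 1\<close>, the next key entering a uniformly chosen gap, just as a random search tree
  grows; the number of keys is geometric at time \<open>t\<close>, as in a Yule process. The formal
  proof does not follow this jump process. It compares two recursions at the root, one for
  permutations and one for waiting times: the Beta integral of the second yields precisely the
  binomial coefficient of the first.

  The obstacle in the first recursion is that a labelled tree does not record key values, so
  different sets of root keys might lead to the same tree. The sizes of the subtrees exclude this,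
  because they fix the ranks of the root keys. The distribution \<open>D\<close> enters only through
  exchangeability and the absence of ties.\<close>

lemma card_permutations_filter_two:
  assumes "finite B"
    and X: "X \<subseteq> permutations_of_set {b \<in> B. P b}"
    and Z: "Z \<subseteq> permutations_of_set {b \<in> B. \<not> P b}"
  shows "card {zs \<in> permutations_of_set B. filter P zs \<in> X \<and> filter (\<lambda>x. \<not> P x) zs \<in> Z} =
    (card B choose card {b \<in> B. P b}) * card X * card Z" (is "card ?S = _")
proof -
  have fin: "finite X" "finite Z"
    using X Z by (auto intro: finite_subset)
  have wz: "distinct w" "distinct z" "set w = {b \<in> B. P b}" "set z = {b \<in> B. \<not> P b}"
    "set w \<inter> set z = {}"
    if "w \<in> X" "z \<in> Z" for w z
    using subsetD[OF X that(1)] subsetD[OF Z that(2)]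
    by (auto simp: permutations_of_set_def)
  have filt: "filter P zs = w \<and> filter (\<lambda>x. \<not> P x) zs = z"
    if "w \<in> X" "z \<in> Z" and zs: "zs \<in> shuffles w z" for w z zs
  proof -
    have "set zs = set w \<union> set z" using zs by (rule set_shuffles)
    then have "filter P zs = filter (\<lambda>x. x \<in> set w) zs"
      and "filter (\<lambda>x. \<not> P x) zs = filter (\<lambda>x. x \<notin> set w) zs"
      using wz[OF that(1,2)] by (auto intro!: filter_cong)
    then show ?thesis
      using filter_shuffles_disjoint1[OF wz(5)[OF that(1,2)] zs] by simp
  qed
  \<comment> \<open>A permutation amounts to its two filtered sublists together with an interleaving
    of them. Filtering recovers the sublists, so the union is disjoint, and the number of
    interleavings depends only on the two lengths.\<close>
  have "?S = (\<Union>(w, z) \<in> X \<times> Z. shuffles w z)"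
  proof (intro set_eqI iffI)
    fix zs assume "zs \<in> ?S"
    then show "zs \<in> (\<Union>(w, z) \<in> X \<times> Z. shuffles w z)"
      using partition_in_shuffles[of zs P] by auto
  next
    fix zs assume "zs \<in> (\<Union>(w, z) \<in> X \<times> Z. shuffles w z)"
    then obtain w z where *: "w \<in> X" "z \<in> Z" "zs \<in> shuffles w z" by auto
    have "distinct zs" "set zs = B"
      using distinct_disjoint_shuffles[OF wz(1,2,5)[OF *(1,2)] *(3)] set_shuffles[OF *(3)]
        wz(3,4)[OF *(1,2)] by auto
    then show "zs \<in> ?S" using filt[OF *] * by auto
  qed
  moreover have "card (\<Union>(w, z) \<in> X \<times> Z. shuffles w z) = (\<Sum>(w, z) \<in> X \<times> Z. card (shuffles w z))"
    using fin filt
    by (subst card_UN_disjoint) (auto simp: case_prod_beta' disjoint_iff, metis+)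
  moreover have "(\<Sum>(w, z) \<in> X \<times> Z. card (shuffles w z)) =
      (\<Sum>_ \<in> X \<times> Z. card B choose card {b \<in> B. P b})"
  proof (intro sum.cong refl, clarsimp)
    fix w z assume *: "w \<in> X" "z \<in> Z"
    have "length w = card {b \<in> B. P b}" "length z = card {b \<in> B. \<not> P b}"
      using wz[OF *] distinct_card by metis+
    moreover have "card B = card {b \<in> B. P b} + card {b \<in> B. \<not> P b}"
      using \<open>finite B\<close> by (subst card_Un_disjoint[symmetric]) (auto intro!: arg_cong[where f = card])
    ultimately show "card (shuffles w z) = card B choose card {b \<in> B. P b}"
      using card_disjoint_shuffles[OF wz(5)[OF *]] by simp
  qed
  ultimately show ?thesis by (simp add: card_cartesian_product)
qed

text \<open>The classes of a partition occur in a uniformly random permutation in independent,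
  uniformly random orders.\<close>

lemma card_permutations_filter:
  assumes "finite I" "finite B" "c ` B \<subseteq> I"
    and "\<And>i. i \<in> I \<Longrightarrow> X i \<subseteq> permutations_of_set {b \<in> B. c b = i}"
  shows "real (card {zs \<in> permutations_of_set B. \<forall>i\<in>I. filter (\<lambda>x. c x = i) zs \<in> X i}) / fact (card B)
    = (\<Prod>i\<in>I. real (card (X i)) / fact (card {b \<in> B. c b = i}))"
  using assms
proof (induction I arbitrary: B rule: finite_induct)
  case empty
  then show ?case by simp
next
  case (insert j I)
  let ?P = "\<lambda>x. c x = j"
  let ?B = "{b \<in> B. \<not> ?P b}"
  let ?Z = "{zs \<in> permutations_of_set ?B. \<forall>i\<in>I. filter (\<lambda>x. c x = i) zs \<in> X i}"
  have class_eq: "{b \<in> ?B. c b = i} = {b \<in> B. c b = i}" if "i \<in> I" for i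
    using that insert.hyps by auto
  have filt: "filter (\<lambda>x. c x = i) (filter (\<lambda>x. \<not> ?P x) zs) = filter (\<lambda>x. c x = i) zs"
    if "i \<in> I" for i zs
    using that insert.hyps by (auto intro!: filter_cong)
  \<comment> \<open>Class \<open>j\<close> against all the others: the induction hypothesis then
    concerns the sublist of elements outside class \<open>j\<close>, whose further filters agree
    with those of the whole list.\<close>
  have "{zs \<in> permutations_of_set B. \<forall>i\<in>insert j I. filter (\<lambda>x. c x = i) zs \<in> X i} =
    {zs \<in> permutations_of_set B. filter ?P zs \<in> X j \<and> filter (\<lambda>x. \<not> ?P x) zs \<in> ?Z}"
    using filt by (auto simp: permutations_of_set_def cong: ball_cong)
  then have "card {zs \<in> permutations_of_set B. \<forall>i\<in>insert j I. filter (\<lambda>x. c x = i) zs \<in> X i} =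
    (card B choose card {b \<in> B. ?P b}) * card (X j) * card ?Z"
    using insert.prems by (simp only:) (rule card_permutations_filter_two, auto)
  moreover have "real (card ?Z) / fact (card ?B) =
      (\<Prod>i\<in>I. real (card (X i)) / fact (card {b \<in> ?B. c b = i}))"
    using insert.prems class_eq by (intro insert.IH) auto
  moreover have "\<dots> = (\<Prod>i\<in>I. real (card (X i)) / fact (card {b \<in> B. c b = i}))"
    using class_eq by (intro prod.cong) auto
  \<comment> \<open>Written with factorials, the number of interleavings cancels
    \<open>fact (card B)\<close> and leaves one factorial for each part; this is what makes the
    orders independent.\<close>
  moreover have "real (card B choose card {b \<in> B. ?P b}) =
      fact (card B) / (fact (card {b \<in> B. ?P b}) * fact (card ?B))"
  proof -
    have "card B = card {b \<in> B. ?P b} + card ?B"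
      using insert.prems(1)
      by (subst card_Un_disjoint[symmetric]) (auto intro!: arg_cong[where f = card])
    then show ?thesis
      using binomial_fact[of "card {b \<in> B. ?P b}" "card B", where 'a = real] by simp
  qed
  ultimately show ?case
    using insert.hyps by (simp add: field_simps)
qed

text \<open>Ranks increase strictly, hence are injective, and counting makes them onto. They serve
  twice: to recognise separators by their ranks, and to replace arbitrary keys by
  \<open>0, ..., n - 1\<close>.\<close>

lemma bij_betw_rank:
  fixes A :: "'a :: linorder set"
  assumes "finite A"
  shows "bij_betw (\<lambda>a. card {x \<in> A. x < a}) A {..<card A}"
proof -
  have *: "card {x \<in> A. x < a} < card {x \<in> A. x < b}" if "a \<in> A" "a < b" for a b
    using assms that by (intro psubset_card_mono) auto
  have inj: "inj_on (\<lambda>a. card {x \<in> A. x < a}) A"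
    by (rule linorder_inj_onI) (use * in force)+
  moreover have "(\<lambda>a. card {x \<in> A. x < a}) ` A \<subseteq> {..<card A}"
    using assms by (auto intro!: psubset_card_mono)
  ultimately show ?thesis
    unfolding bij_betw_def by (simp add: card_image card_subset_eq)
qed

text \<open>An element of \<open>R\<close> with \<open>i\<close> predecessors in \<open>R\<close> has rank \<open>i\<close> plus the sizes of the first
  \<open>i + 1\<close> gaps in \<open>A\<close>, so the gap sizes determine the ranks.\<close>

lemma separators_eqI:
  fixes A :: "'a :: linorder set"
  assumes A: "finite A" and R: "R \<subseteq> A" "R' \<subseteq> A" "card R = card R'"
    and gaps: "\<And>i. i \<le> card R \<Longrightarrow> card {x \<in> A - R. card {y \<in> R. y < x} = i} =
      card {x \<in> A - R'. card {y \<in> R'. y < x} = i}"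
  shows "R = R'"
proof -
  have rank: "card {x \<in> A. x < r} = card {y \<in> S. y < r} +
      (\<Sum>l\<le>card {y \<in> S. y < r}. card {x \<in> A - S. card {y \<in> S. y < x} = l})"
    if S: "S \<subseteq> A" and r: "r \<in> S" for S r
  proof -
    let ?i = "card {y \<in> S. y < r}"
    have fin: "finite S" using S A by (rule finite_subset)
    \<comment> \<open>If \<open>r < x\<close>, then \<open>r\<close> itself is an additional
      predecessor of \<open>x\<close> in \<open>S\<close>, so the gap index of \<open>x\<close>
      exceeds \<open>?i\<close>. The case \<open>x = r\<close> is excluded by
      \<open>x \<notin> S\<close>.\<close>
    have less: "x < r \<longleftrightarrow> card {y \<in> S. y < x} \<le> ?i" if "x \<in> A - S" for x
    proof
      assume "x < r"
      then show "card {y \<in> S. y < x} \<le> ?i"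
        using fin by (intro card_mono) auto
    next
      assume le: "card {y \<in> S. y < x} \<le> ?i"
      show "x < r"
      proof (rule ccontr)
        assume "\<not> x < r"
        then have "r < x" using that r by (metis DiffD2 linorder_neqE)
        then have "?i < card {y \<in> S. y < x}"
          using fin r by (intro psubset_card_mono) auto
        with le show False by simp
      qed
    qed
    have "{x \<in> A. x < r} = {y \<in> S. y < r} \<union>
        (\<Union>l\<le>?i. {x \<in> A - S. card {y \<in> S. y < x} = l})"
      using S less by auto
    also have "card \<dots> = ?i + card (\<Union>l\<le>?i. {x \<in> A - S. card {y \<in> S. y < x} = l})"
      using fin A by (intro card_Un_disjoint) auto
    also have "card (\<Union>l\<le>?i. {x \<in> A - S. card {y \<in> S. y < x} = l}) =
        (\<Sum>l\<le>?i. card {x \<in> A - S. card {y \<in> S. y < x} = l})"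
      using A by (intro card_UN_disjoint) auto
    finally show ?thesis .
  qed
  let ?rank = "\<lambda>r. card {x \<in> A. x < r}"
  let ?g = "\<lambda>S i. i + (\<Sum>l\<le>i. card {x \<in> A - S. card {y \<in> S. y < x} = l})"
  \<comment> \<open>The number of predecessors within \<open>S\<close> takes each value below
    \<open>card S\<close>, so the set of ranks is expressed by gap sizes alone, without mention of
    the elements of \<open>S\<close>.\<close>
  have image: "?rank ` S = ?g S ` {..<card S}" if "S \<subseteq> A" for S
  proof -
    have "finite S" using that A by (rule finite_subset)
    have "?rank ` S = ?g S ` (\<lambda>r. card {y \<in> S. y < r}) ` S"
      unfolding image_image using rank[OF that] by (intro image_cong) auto
    then show ?thesis
      using bij_betw_rank[OF \<open>finite S\<close>] by (simp add: bij_betw_def)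
  qed
  have "?g R ` {..<card R} = ?g R' ` {..<card R}"
    using gaps by (intro image_cong refl arg_cong2[where f = plus] sum.cong) auto
  then have "?rank ` R = ?rank ` R'"
    using image[OF R(1)] image[OF R(2)] R(3) by simp
  then show ?thesis
    using inj_on_image_eq_iff[OF bij_betw_imp_inj_on[OF bij_betw_rank[OF A]] R(1,2)] by simp
qed

subsection \<open>Search trees of random permutations\<close>

text \<open>Gaps are numbered from 0 and child positions from 1: these are the keys passed on to
  child \<open>Suc i\<close> of a full root, in order of arrival.\<close>

definition subkeys :: "nat \<Rightarrow> real list \<Rightarrow> nat \<Rightarrow> real list" where
  "subkeys m xs i = filter (\<lambda>x. card {y \<in> set (take (m - 1) xs). y < x} = i) (drop (m - 1) xs)"

lemma distinct_subkeys: "distinct xs \<Longrightarrow> distinct (subkeys m xs i)"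
  by (simp add: subkeys_def)

lemma search_tree_short:
  assumes "length xs < m - 1"
  shows "search_tree m xs = [[] \<mapsto> length xs]"
proof
  fix u show "search_tree m xs u = [[] \<mapsto> length xs] u"
    using assms by (cases u) auto
qed

lemma search_tree_Nil_full: "m - 1 \<le> length xs \<Longrightarrow> search_tree m xs [] = Some (m - 1)"
  by simp

lemma search_tree_Suc:
  assumes "m - 1 \<le> length xs" "i < m"
  shows "search_tree m xs (Suc i # u) = search_tree m (subkeys m xs i) u"
  using assms by (simp add: subkeys_def)

lemma search_tree_outside: "i \<notin> {1..m} \<Longrightarrow> search_tree m xs (i # u) = None"
  by auto

text \<open>Both roots are full and so carry the same label, and positions outside
  \<open>1, ..., m\<close> are empty in both trees; only the \<open>m\<close> subtrees can
  differ.\<close>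

lemma search_tree_eq_iff:
  assumes "m - 1 \<le> length xs" "m - 1 \<le> length ys"
  shows "search_tree m xs = search_tree m ys \<longleftrightarrow>
    (\<forall>i<m. search_tree m (subkeys m xs i) = search_tree m (subkeys m ys i))"
proof (intro iffI allI impI)
  fix i assume "search_tree m xs = search_tree m ys" "i < m"
  then show "search_tree m (subkeys m xs i) = search_tree m (subkeys m ys i)"
    using search_tree_Suc[OF assms(1), of i] search_tree_Suc[OF assms(2), of i] by auto
next
  assume *: "\<forall>i<m. search_tree m (subkeys m xs i) = search_tree m (subkeys m ys i)"
  show "search_tree m xs = search_tree m ys"
  proof
    fix v
    show "search_tree m xs v = search_tree m ys v"
    proof (cases v)
      case Nil
      then show ?thesis using assms by simp
    next
      case (Cons j u)
      show ?thesis
      proof (cases "j \<in> {1..m}")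
        case True
        then obtain i where "j = Suc i" "i < m" by (cases j) auto
        then show ?thesis using Cons * search_tree_Suc assms by metis
      next
        case False
        then show ?thesis using Cons by auto
      qed
    qed
  qed
qed

lemma sum_length_filter:
  assumes "finite I" "\<And>x. x \<in> set zs \<Longrightarrow> f x \<in> I"
  shows "(\<Sum>i\<in>I. length (filter (\<lambda>x. f x = i) zs)) = length zs"
  using assms(2)
proof (induction zs)
  case (Cons z zs)
  have "(\<Sum>i\<in>I. length (filter (\<lambda>x. f x = i) (z # zs))) =
      (\<Sum>i\<in>I. (if f z = i then 1 else 0) + length (filter (\<lambda>x. f x = i) zs))"
    by (intro sum.cong) auto
  also have "\<dots> = length (z # zs)"
    using Cons assms(1) by (simp add: sum.distrib)
  finally show ?case .
qed simp

lemma card_less_take: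
  "card {y \<in> set (take (m - 1) xs). y < x} \<le> m - 1" for x :: real
  by (rule order_trans[OF card_mono[OF _ Collect_restrict]])
    (auto intro: order_trans[OF card_length])

lemma sum_length_subkeys:
  assumes "m \<ge> 1" "m - 1 \<le> length xs"
  shows "length xs = m - 1 + (\<Sum>i<m. length (subkeys m xs i))"
proof -
  have "card {y \<in> set (take (m - 1) xs). y < x} < m" for x
    using card_less_take[of m xs x] assms(1) by linarith
  then have "(\<Sum>i<m. length (subkeys m xs i)) = length (drop (m - 1) xs)"
    unfolding subkeys_def by (intro sum_length_filter) auto
  then show ?thesis using assms by simp
qed

lemma length_subkeys_less:
  assumes "m \<ge> 2" "m - 1 \<le> length xs"
  shows "length (subkeys m xs i) < length xs"
proof -
  have "length (subkeys m xs i) \<le> length (drop (m - 1) xs)"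
    unfolding subkeys_def by (rule length_filter_le)
  then show ?thesis using assms by simp
qed

lemma infsum_Sigma_finite:
  fixes f :: "'a \<times> 'b \<Rightarrow> ennreal"
  assumes "finite A"
  shows "infsum f (Sigma A B) = (\<Sum>a\<in>A. infsum (\<lambda>b. f (a, b)) (B a))"
  using assms
proof (induction A rule: finite_induct)
  case (insert a A)
  have "Sigma (insert a A) B = Pair a ` B a \<union> Sigma A B" by auto
  then have "infsum f (Sigma (insert a A) B) = infsum f (Pair a ` B a) + infsum f (Sigma A B)"
    using insert.hyps
    by (simp only:) (intro infsum_Un_disjoint nonneg_summable_on_complete; auto)
  also have "infsum f (Pair a ` B a) = infsum (\<lambda>b. f (a, b)) (B a)"
    by (subst infsum_reindex) (auto simp: inj_on_def o_def)
  finally show ?case using insert by simp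
qed simp

text \<open>The domain is the root together with disjoint prefixed copies of the domains of the
  subtrees. The recursion is well-founded because \<open>m \<ge> 2\<close> makes every list of
  passed keys strictly shorter. As a consequence, equal search trees come from equally long key
  lists.\<close>

lemma num_keys_search_tree:
  assumes "m \<ge> 2"
  shows "num_keys (search_tree m xs) = of_nat (length xs)"
proof (induction xs rule: length_induct)
  case (1 xs)
  show ?case
  proof (cases "length xs < m - 1")
    case True
    have "dom [([] :: nat list) \<mapsto> length xs] = {[]}" by simp
    then show ?thesis unfolding num_keys_def search_tree_short[OF True] by (simp only:) simp
  next
    case False
    let ?T = "search_tree m xs" and ?S = "\<lambda>i. search_tree m (subkeys m xs i)"
    let ?g = "\<lambda>(i, u). Suc i # u"
    have len: "m - 1 \<le> length xs" using False by simp
    have "v \<in> dom ?T \<longleftrightarrow> v \<in> insert [] (?g ` Sigma {..<m} (\<lambda>i. dom (?S i)))" for v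
    proof (cases v)
      case (Cons j u)
      show ?thesis
      proof (cases "j \<in> {1..m}")
        case True
        then obtain i where i: "j = Suc i" "i < m" by (cases j) auto
        then show ?thesis
          using search_tree_Suc[OF len i(2), of u] by (force simp: Cons dom_def)
      next
        case False
        then show ?thesis using search_tree_outside[OF False, of xs u] by (auto simp: Cons dom_def)
      qed
    qed (use len in auto)
    then have dom: "dom ?T = insert [] (?g ` Sigma {..<m} (\<lambda>i. dom (?S i)))" by blast
    have "num_keys ?T = of_nat (m - 1) + infsum (\<lambda>u. of_nat (the (?T u)))
        (?g ` Sigma {..<m} (\<lambda>i. dom (?S i)))"
      unfolding num_keys_def dom using search_tree_Nil_full[OF len]
      by (subst infsum_insert)
        (auto simp del: search_tree.simps intro!: nonneg_summable_on_complete)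
    also have "infsum (\<lambda>u. of_nat (the (?T u))) (?g ` Sigma {..<m} (\<lambda>i. dom (?S i))) =
        (infsum (\<lambda>(i, u). of_nat (the (?S i u))) (Sigma {..<m} (\<lambda>i. dom (?S i))) :: ennreal)"
      by (subst infsum_reindex)
        (auto simp: inj_on_def search_tree_Suc[OF len] simp del: search_tree.simps intro!: infsum_cong)
    also have "\<dots> = (\<Sum>i<m. num_keys (?S i))"
      by (subst infsum_Sigma_finite) (auto simp: num_keys_def)
    also have "\<dots> = (\<Sum>i<m. of_nat (length (subkeys m xs i)))"
      using 1 length_subkeys_less[OF assms len] by (intro sum.cong) auto
    also have "of_nat (m - 1) + \<dots> = (of_nat (length xs) :: ennreal)"
      unfolding of_nat_sum[symmetric] of_nat_add[symmetric]
      using sum_length_subkeys[of m xs] assms len by (simp only:)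
    finally show ?thesis .
  qed
qed

lemma search_tree_eq_lengthD:
  assumes "m \<ge> 2" "search_tree m xs = search_tree m ys"
  shows "length xs = length ys"
  using assms num_keys_search_tree[of m xs] num_keys_search_tree[of m ys] by simp

text \<open>The construction only compares keys with each other, so the tree depends on their
  relative order alone.\<close>

lemma search_tree_map_mono:
  assumes "strict_mono_on (set xs) f"
  shows "search_tree m (map f xs) = search_tree m xs"
proof
  fix u show "search_tree m (map f xs) u = search_tree m xs u"
    using assms
  proof (induction u arbitrary: xs)
    case Nil
    then show ?case by simp
  next
    case (Cons i u)
    have mono: "f y < f x \<longleftrightarrow> y < x" if "x \<in> set xs" "y \<in> set xs" for x y
      using that Cons.prems strict_mono_onD linorder_cases order_less_asym by metis
    have "card {y \<in> set (take (m - 1) (map f xs)). y < f x} =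
        card {y \<in> set (take (m - 1) xs). y < x}" if "x \<in> set xs" for x
    proof -
      have "{y \<in> set (take (m - 1) (map f xs)). y < f x} = f ` {y \<in> set (take (m - 1) xs). y < x}"
        using mono that in_set_takeD[of _ "m - 1" xs] by (force simp: take_map)
      then show ?thesis
        using Cons.prems
        by (auto intro!: card_image inj_on_subset[OF strict_mono_on_imp_inj_on[OF Cons.prems]]
            dest!: in_set_takeD)
    qed
    then have "filter (\<lambda>x. card {y \<in> set (take (m - 1) (map f xs)). y < x} = i - 1)
          (drop (m - 1) (map f xs)) =
        map f (filter (\<lambda>x. card {y \<in> set (take (m - 1) xs). y < x} = i - 1) (drop (m - 1) xs))"
      (is "_ = map f ?zs")
      unfolding drop_map filter_map o_def
      by (intro arg_cong[where f = "map f"] filter_cong) (auto dest!: in_set_dropD)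
    moreover have "search_tree m (map f ?zs) u = search_tree m ?zs u"
      by (intro Cons.IH monotone_on_subset[OF Cons.prems]) (auto dest: in_set_dropD)
    ultimately show ?case by simp
  qed
qed

text \<open>This is \<open>c(T)\<close> of the overview, with \<open>n\<close> as a separate
  argument; for \<open>m \<ge> 2\<close> it vanishes unless \<open>T\<close> has exactly
  \<open>n\<close> keys. The keys \<open>0, ..., n - 1\<close> are a normal form for any
  \<open>n\<close> distinct reals.\<close>

definition search_prob :: "nat \<Rightarrow> nat \<Rightarrow> ltree \<Rightarrow> real" where
  "search_prob m n T =
     card {xs \<in> permutations_of_set (real ` {..<n}). search_tree m xs = T} / fact n"

lemma image_Collect_eq:
  assumes "\<And>x. x \<in> P \<Longrightarrow> h (g x) = h x"
  shows "g ` {x \<in> P. h x = t} = {y \<in> g ` P. h y = t}"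
  using assms by auto

text \<open>Replacing every key by its rank is a strictly increasing bijection, which leaves search
  trees unchanged. This makes \<open>search_prob\<close> applicable to the keys of one gap and to
  the values of a random sample.\<close>

lemma search_prob_altdef:
  assumes "finite A"
  shows "card {xs \<in> permutations_of_set A. search_tree m xs = T} / fact (card A) =
    search_prob m (card A) T"
proof -
  let ?f = "\<lambda>x. real (card {y \<in> A. y < x})"
  have bij: "bij_betw (real \<circ> (\<lambda>x. card {y \<in> A. y < x})) A (real ` {..<card A})"
    by (rule bij_betw_trans[OF bij_betw_rank[OF assms]]) (auto intro: inj_on_imp_bij_betw)
  then have inj: "inj_on ?f A" and img: "?f ` A = real ` {..<card A}"
    by (auto simp: bij_betw_def o_def)
  have mono: "strict_mono_on A ?f"
    using assms by (auto intro!: strict_mono_onI psubset_card_mono)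
  have "bij_betw (map ?f) {xs \<in> permutations_of_set A. search_tree m xs = T}
    {xs \<in> permutations_of_set (real ` {..<card A}). search_tree m xs = T}"
    unfolding bij_betw_def
  proof
    show "inj_on (map ?f) {xs \<in> permutations_of_set A. search_tree m xs = T}"
      using inj by (intro inj_on_mapI) (auto simp: permutations_of_set_def elim: inj_on_subset)
    have tree: "search_tree m (map ?f xs) = search_tree m xs" if "xs \<in> permutations_of_set A" for xs
      using that mono by (intro search_tree_map_mono) (auto simp: permutations_of_set_def)
    show "map ?f ` {xs \<in> permutations_of_set A. search_tree m xs = T} =
        {xs \<in> permutations_of_set (real ` {..<card A}). search_tree m xs = T}"
      unfolding img[symmetric] permutations_of_set_image_inj[OF inj]
      using tree by (rule image_Collect_eq)
  qed
  then show ?thesis by (simp add: search_prob_def bij_betw_same_card)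
qed

lemma search_prob_nonneg: "search_prob m n T \<ge> 0"
  by (simp add: search_prob_def)

lemma search_prob_short:
  assumes "length xs < m - 1"
  shows "search_prob m (length xs) (search_tree m xs) = 1"
proof -
  have "search_tree m ys = search_tree m xs"
    if "ys \<in> permutations_of_set (real ` {..<length xs})" for ys
  proof -
    have "length ys = length xs"
      using length_finite_permutations_of_set[OF that] by (simp add: card_image)
    then show ?thesis using search_tree_short[of ys m] search_tree_short[of xs m] assms by metis
  qed
  then have "{ys \<in> permutations_of_set (real ` {..<length xs}). search_tree m ys = search_tree m xs} =
      permutations_of_set (real ` {..<length xs})"
    by blast
  then show ?thesis by (simp add: search_prob_def card_image)
qed

lemma subkeys_append:
  assumes "length ys = m - 1"
  shows "subkeys m (ys @ zs) i = filter (\<lambda>x. card {y \<in> set ys. y < x} = i) zs"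
  using assms by (simp add: subkeys_def)

text \<open>The tree fixes the set \<open>?R\<close> of root keys. Hence a permutation yields this
  tree iff it is any ordering of \<open>?R\<close> followed by an ordering of the rest whose
  restriction to each gap yields the right subtree. The first part contributes
  \<open>fact (m - 1)\<close>; the gaps are independent by
  \<open>card_permutations_filter\<close>.\<close>

lemma search_prob_rec:
  assumes m: "m \<ge> 2" and xs: "distinct xs" "m - 1 \<le> length xs"
  shows "search_prob m (length xs) (search_tree m xs) =
    (\<Prod>i<m. search_prob m (length (subkeys m xs i)) (search_tree m (subkeys m xs i))) /
      (length xs choose (m - 1))"
proof -
  let ?A = "set xs" and ?R = "set (take (m - 1) xs)"
  let ?B = "?A - ?R"
  let ?c = "\<lambda>x. card {y \<in> ?R. y < x}"
  let ?X = "\<lambda>i. {ws \<in> permutations_of_set {b \<in> ?B. ?c b = i}.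
    search_tree m ws = search_tree m (subkeys m xs i)}"
  let ?Z = "{zs \<in> permutations_of_set ?B. \<forall>i\<in>{..<m}. filter (\<lambda>x. ?c x = i) zs \<in> ?X i}"
  have card_A: "card ?A = length xs" using xs by (simp add: distinct_card)
  have dist: "set (take (m - 1) ys) \<inter> set (drop (m - 1) ys) = {}" if "distinct ys"
    for ys :: "real list"
    using that distinct_append[of "take (m - 1) ys" "drop (m - 1) ys"] by simp
  have split: "set (drop (m - 1) ys) = set ys - set (take (m - 1) ys)" if "distinct ys"
    for ys :: "real list"
    using dist[OF that] set_append[of "take (m - 1) ys" "drop (m - 1) ys"]
    unfolding append_take_drop_id by auto
  have card_R: "card ?R = m - 1"
    using xs by (simp add: distinct_card min_def)
  have card_B: "card ?B = length xs - (m - 1)"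
    using card_A card_R set_take_subset[of "m - 1" xs] by (simp only: card_Diff_subset finite_set)
  have gap: "card {x \<in> set ys - set (take (m - 1) ys).
      card {y \<in> set (take (m - 1) ys). y < x} = i} = length (subkeys m ys i)"
    if "distinct ys" for ys i
    unfolding split[OF that, symmetric] subkeys_def set_filter[symmetric]
    using that by (intro distinct_card) simp
  \<comment> \<open>Equal trees have equal subtrees, hence equally many keys in each gap, and the
    gap sizes determine the separators.\<close>
  have R_eq: "set (take (m - 1) ys) = ?R"
    if ys: "ys \<in> permutations_of_set ?A" "search_tree m ys = search_tree m xs" for ys
  proof -
    have d: "distinct ys" "set ys = ?A" using ys by (auto simp: permutations_of_set_def)
    have len: "length ys = length xs" using m ys(2) by (rule search_tree_eq_lengthD)
    have trees: "\<forall>i<m. search_tree m (subkeys m ys i) = search_tree m (subkeys m xs i)"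
      using ys(2) xs len by (subst (asm) search_tree_eq_iff) auto
    have "?R = set (take (m - 1) ys)"
    proof (rule separators_eqI[where A = ?A])
      show "card ?R = card (set (take (m - 1) ys))"
        using card_R d(1) len xs by (simp add: distinct_card)
      fix i assume "i \<le> card ?R"
      then have "i < m" using card_R m by simp
      then have "length (subkeys m xs i) = length (subkeys m ys i)"
        using trees search_tree_eq_lengthD[OF m] by metis
      then show "card {x \<in> ?A - ?R. ?c x = i} = card {x \<in> ?A - set (take (m - 1) ys).
          card {y \<in> set (take (m - 1) ys). y < x} = i}"
        using gap[OF d(1)] gap[OF xs(1)] d(2) by simp
    qed (use d(2) set_take_subset[of "m - 1" ys] set_take_subset[of "m - 1" xs] in auto)
    then show ?thesis ..
  qed
  have tree_iff: "search_tree m (ws @ zs) = search_tree m xs \<longleftrightarrow> zs \<in> ?Z"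
    if ws: "ws \<in> permutations_of_set ?R" and zs: "zs \<in> permutations_of_set ?B" for ws zs
  proof -
    have ws': "set ws = ?R" "length ws = m - 1"
      using ws card_R length_finite_permutations_of_set[OF ws] by (auto simp: permutations_of_set_def)
    have "search_tree m (ws @ zs) = search_tree m xs \<longleftrightarrow>
        (\<forall>i<m. search_tree m (filter (\<lambda>x. ?c x = i) zs) = search_tree m (subkeys m xs i))"
      using xs(2) ws' by (subst search_tree_eq_iff) (auto simp: subkeys_append)
    moreover have "filter (\<lambda>x. ?c x = i) zs \<in> permutations_of_set {b \<in> ?B. ?c b = i}" for i
      using zs by (auto simp: permutations_of_set_def)
    ultimately show ?thesis using zs by auto
  qed
  have "bij_betw (\<lambda>(ws, zs). ws @ zs) (permutations_of_set ?R \<times> ?Z)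
    {ys \<in> permutations_of_set ?A. search_tree m ys = search_tree m xs}"
    unfolding bij_betw_def
  proof
    show "inj_on (\<lambda>(ws, zs). ws @ zs) (permutations_of_set ?R \<times> ?Z)"
      by (auto simp: inj_on_def dest!: length_finite_permutations_of_set)
    show "(\<lambda>(ws, zs). ws @ zs) ` (permutations_of_set ?R \<times> ?Z) =
      {ys \<in> permutations_of_set ?A. search_tree m ys = search_tree m xs}"
    proof (intro set_eqI iffI)
      fix ys assume "ys \<in> (\<lambda>(ws, zs). ws @ zs) ` (permutations_of_set ?R \<times> ?Z)"
      then obtain ws zs where *: "ys = ws @ zs" "ws \<in> permutations_of_set ?R" "zs \<in> ?Z" by auto
      then have "zs \<in> permutations_of_set ?B" by auto
      then have "ys \<in> permutations_of_set ?A"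
        using * set_take_subset[of "m - 1" xs] by (auto simp: permutations_of_set_def)
      moreover have "search_tree m ys = search_tree m xs"
        using tree_iff[OF *(2) \<open>zs \<in> permutations_of_set ?B\<close>] *(1,3) by blast
      ultimately show "ys \<in> {ys \<in> permutations_of_set ?A. search_tree m ys = search_tree m xs}"
        by blast
    next
      fix ys assume ys: "ys \<in> {ys \<in> permutations_of_set ?A. search_tree m ys = search_tree m xs}"
      let ?w = "take (m - 1) ys" and ?z = "drop (m - 1) ys"
      have d: "distinct ys" "set ys = ?A" using ys by (auto simp: permutations_of_set_def)
      have R: "set ?w = ?R" using R_eq ys by blast
      have w: "?w \<in> permutations_of_set ?R" using d R by (auto simp: permutations_of_set_def)
      have z: "?z \<in> permutations_of_set ?B" 
        using d split[OF d(1)] R by (auto simp: permutations_of_set_def)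
      have "?z \<in> ?Z" using tree_iff[OF w z] ys by simp
      then show "ys \<in> (\<lambda>(ws, zs). ws @ zs) ` (permutations_of_set ?R \<times> ?Z)"
        using w by (intro image_eqI[where x = "(?w, ?z)"]) auto
    qed
  qed
  then have "real (card {ys \<in> permutations_of_set ?A. search_tree m ys = search_tree m xs}) =
      fact (m - 1) * card ?Z"
    using card_R by (simp add: bij_betw_same_card[symmetric] card_cartesian_product)
  then have 1: "search_prob m (length xs) (search_tree m xs) = fact (m - 1) * card ?Z / fact (length xs)"
    unfolding search_prob_altdef[of ?A, OF finite_set, unfolded card_A, symmetric]
    by (simp only: of_nat_mult of_nat_fact)
  have 2: "card ?Z / fact (card ?B) = (\<Prod>i<m. card (?X i) / fact (card {b \<in> ?B. ?c b = i}))"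
  proof (rule card_permutations_filter[where c = ?c and X = ?X])
    have "?c x < m" for x
      using card_less_take[of m xs x] m by linarith
    then show "?c ` ?B \<subseteq> {..<m}" by blast
  qed auto
  have 3: "(\<Prod>i<m. card (?X i) / fact (card {b \<in> ?B. ?c b = i})) =
      (\<Prod>i<m. search_prob m (length (subkeys m xs i)) (search_tree m (subkeys m xs i)))"
    unfolding gap[OF xs(1), symmetric] by (intro prod.cong refl search_prob_altdef) auto
  \<comment> \<open>\<open>fact (card ?B)\<close> normalises the count over the remaining keys; what
    is left of the three factorials is the probability that the first \<open>m - 1\<close> keys form
    one prescribed set.\<close>
  have 4: "fact (m - 1) * z / fact (length xs) = (z / fact (card ?B)) / real (length xs choose (m - 1))"
    for z :: real
    unfolding card_B using xs by (simp add: binomial_fact)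
  show ?thesis unfolding 1 of_nat_mult of_nat_fact 4 2 3 ..
qed

subsection \<open>Exponential and Beta integrals\<close>

text \<open>Integration by parts trades a factor \<open>a - x\<close> for a factor \<open>x - c\<close>.\<close>

lemma beta_antiderivative:
  fixes a c :: real
  shows "\<exists>F. (\<forall>x. (F has_real_derivative (x - c) ^ n * (a - x) ^ r) (at x)) \<and>
    F a - F c = (a - c) ^ (n + r + 1) * fact n * fact r / fact (n + r + 1)"
proof (induction r arbitrary: n)
  case 0
  let ?F = "\<lambda>x. (x - c) ^ (n + 1) / real (n + 1)"
  have "(?F has_real_derivative (x - c) ^ n * (a - x) ^ 0) (at x)" for x
    by (auto intro!: derivative_eq_intros simp del: power_Suc)
  moreover have "?F a - ?F c = (a - c) ^ (n + 0 + 1) * fact n * fact 0 / fact (n + 0 + 1)"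
    by (simp del: of_nat_Suc)
  ultimately show ?case by blast
next
  case (Suc r)
  obtain F where F: "\<And>x. (F has_real_derivative (x - c) ^ (n + 1) * (a - x) ^ r) (at x)"
    "F a - F c = (a - c) ^ (n + 1 + r + 1) * fact (n + 1) * fact r / fact (n + 1 + r + 1)"
    using Suc.IH[of "n + 1"] by blast
  let ?G = "\<lambda>x. ((x - c) ^ (n + 1) * (a - x) ^ (r + 1) + real (r + 1) * F x) / real (n + 1)"
  have "(?G has_real_derivative (x - c) ^ n * (a - x) ^ Suc r) (at x)" for x
    by (rule derivative_eq_intros F(1) refl | simp)+
  moreover have "?G a - ?G c = (a - c) ^ (n + Suc r + 1) * fact n * fact (Suc r) / fact (n + Suc r + 1)"
  proof -
    \<comment> \<open>The boundary term contains both \<open>x - c\<close> and \<open>a - x\<close>,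
      so it vanishes at both endpoints and only \<open>F\<close> contributes.\<close>
    have "?G a - ?G c = real (r + 1) / real (n + 1) * (F a - F c)"
      by (simp add: diff_divide_distrib right_diff_distrib)
    also have "\<dots> = (a - c) ^ (n + Suc r + 1) * fact n * fact (Suc r) / fact (n + Suc r + 1)"
      unfolding F(2) by (simp add: divide_simps)
    finally show ?thesis .
  qed
  ultimately show ?case by blast
qed

text \<open>The density of the maximum of \<open>n\<close> independent standard exponential variables, which is
  also that of a sum of independent exponential variables with rates \<open>1, \<dots>, n\<close>.\<close>

definition yule_density :: "nat \<Rightarrow> real \<Rightarrow> real" where
  "yule_density n s = (if s < 0 then 0 else n * exp (- s) * (1 - exp (- s)) ^ (n - 1))"

lemma yule_density_nonneg: "yule_density n s \<ge> 0"
  by (simp add: yule_density_def)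

lemma yule_density_measurable [measurable]: "yule_density n \<in> borel_measurable borel"
  unfolding yule_density_def by measurable

lemma yule_density_1: "yule_density 1 = exponential_density 1"
  by (auto simp: fun_eq_iff yule_density_def exponential_density_def)

lemma yule_density_convolution:
  assumes "n \<ge> 1"
  shows "(\<integral>\<^sup>+y. ennreal (yule_density n (x - y)) * ennreal (exponential_density (real (n + 1)) y) \<partial>lborel) =
    ennreal (yule_density (n + 1) x)"
proof (cases "x < 0")
  case True
  then have "ennreal (yule_density n (x - y)) * ennreal (exponential_density (real (n + 1)) y) = 0" for y
    by (auto simp: yule_density_def exponential_density_def)
  then have "(\<integral>\<^sup>+y. ennreal (yule_density n (x - y)) * ennreal (exponential_density (real (n + 1)) y) \<partial>lborel) = 0"
    by (simp only:) simp
  then show ?thesis using True by (simp add: yule_density_def)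
next
  case False
  \<comment> \<open>Taking \<open>exp (- (x - y))\<close> out of each factor
    \<open>1 - exp (- (x - y))\<close> leaves a constant times powers of \<open>exp (x - y)\<close>
    and \<open>exp (x - y) - 1\<close>. The rate \<open>n + 1\<close> is what makes the remaining
    exponent equal to one, so that \<open>?F\<close> is an antiderivative.\<close>
  let ?f = "\<lambda>y. real (n + 1) * exp (- real (n + 1) * x) * (n * exp (x - y) * (exp (x - y) - 1) ^ (n - 1))"
  let ?F = "\<lambda>y. - (real (n + 1) * exp (- real (n + 1) * x) * (exp (x - y) - 1) ^ n)"
  have "(\<integral>\<^sup>+y. ennreal (yule_density n (x - y)) * ennreal (exponential_density (real (n + 1)) y) \<partial>lborel) =
      (\<integral>\<^sup>+y. ennreal (?f y) * indicator {0..x} y \<partial>lborel)"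
  proof (rule nn_integral_cong)
    fix y
    show "ennreal (yule_density n (x - y)) * ennreal (exponential_density (real (n + 1)) y) =
        ennreal (?f y) * indicator {0..x} y"
    proof (cases "y \<in> {0..x}")
      case True
      have pow: "exp (y - x) ^ (n - 1) * (exp (x - y) - 1) ^ (n - 1) = (1 - exp (y - x)) ^ (n - 1)"
        by (simp add: power_mult_distrib[symmetric] algebra_simps exp_add[symmetric])
      have "yule_density n (x - y) * exponential_density (real (n + 1)) y =
          n * exp (y - x) * (1 - exp (y - x)) ^ (n - 1) * (real (n + 1) * exp (- (real (n + 1) * y)))"
        using True by (simp add: yule_density_def exponential_density_def mult.commute[of y])
      also have "\<dots> = real (n + 1) * n *
          (exp (y - x) * exp (y - x) ^ (n - 1) * exp (- (real (n + 1) * y))) * (exp (x - y) - 1) ^ (n - 1)"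
        unfolding pow[symmetric] by (simp only: mult_ac)
      also have "exp (y - x) * exp (y - x) ^ (n - 1) = exp (real n * (y - x))"
        using assms by (simp add: exp_of_nat_mult power_Suc[symmetric] del: power_Suc)
      also have "\<dots> * exp (- (real (n + 1) * y)) = exp (- real (n + 1) * x) * exp (x - y)"
        by (simp add: exp_add[symmetric] algebra_simps)
      finally have "yule_density n (x - y) * exponential_density (real (n + 1)) y = ?f y"
        by (simp add: mult_ac)
      then show ?thesis
        using True by (simp add: ennreal_mult'[symmetric] yule_density_nonneg)
    next
      case False
      then show ?thesis by (auto simp: yule_density_def exponential_density_def)
    qed
  qed
  also have "\<dots> = ennreal (?F x - ?F 0)"
  proof (rule nn_integral_FTC_Icc[where F = ?F])
    show "(?F has_real_derivative ?f y) (at y)" for y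
      using assms by (auto intro!: derivative_eq_intros)
    show "0 \<le> ?f y" if "y \<in> {0..x}" for y
      using that by simp
  qed (use False in auto)
  also have "?F x - ?F 0 = real (n + 1) * (exp (- real (n + 1) * x) * (exp x - 1) ^ n)"
    using assms by (simp add: zero_power)
  also have "exp (- real (n + 1) * x) = exp (- x) * exp (- x) ^ n"
    by (simp add: exp_of_nat_mult[symmetric] exp_add[symmetric] algebra_simps)
  also have "exp (- x) * exp (- x) ^ n * (exp x - 1) ^ n = exp (- x) * (1 - exp (- x)) ^ n"
    by (simp add: power_mult_distrib[symmetric] algebra_simps exp_add[symmetric])
  finally show ?thesis
    using False by (simp add: yule_density_def mult_ac)
qed

lemma nn_integral_yule_density_atMost:
  assumes "n \<ge> 1" "t \<ge> 0"
  shows "(\<integral>\<^sup>+s. ennreal (yule_density n s) * indicator {..t} s \<partial>lborel) = ennreal ((1 - exp (- t)) ^ n)"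
proof -
  let ?f = "\<lambda>s. n * exp (- s) * (1 - exp (- s)) ^ (n - 1) :: real"
  have "(\<integral>\<^sup>+s. ennreal (yule_density n s) * indicator {..t} s \<partial>lborel) =
      (\<integral>\<^sup>+s. ennreal (?f s) * indicator {0..t} s \<partial>lborel)"
    by (intro nn_integral_cong) (auto simp: yule_density_def indicator_def)
  also have "\<dots> = ennreal ((1 - exp (- t)) ^ n - (1 - exp (- 0)) ^ n)"
    using assms by (intro nn_integral_FTC_Icc[where F = "\<lambda>s. (1 - exp (- s)) ^ n"]) (auto intro!: derivative_eq_intros)
  finally show ?thesis using assms by (simp add: zero_power)
qed

text \<open>The root splits at time \<open>s\<close>; each of the \<open>m\<close> subtrees then
  contributes a factor \<open>exp (- (t - s))\<close>, and the \<open>r\<close> keys passed on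
  contribute the power of \<open>1 - exp (- (t - s))\<close>. The substitution
  \<open>x = exp s\<close> gives a Beta integral over the interval from \<open>1\<close> to
  \<open>exp t\<close>.\<close>

lemma nn_integral_yule_density_split:
  fixes m r :: nat
  assumes "m \<ge> 2" "t \<ge> 0"
  shows "(\<integral>\<^sup>+s. ennreal (yule_density (m - 1) s * (exp (- (t - s)) ^ m * (1 - exp (- (t - s))) ^ r)) *
      indicator {..t} s \<partial>lborel) =
    ennreal (exp (- t) * (1 - exp (- t)) ^ (m - 1 + r) / ((m - 1 + r) choose (m - 1)))"
proof -
  obtain q where m: "m = q + 2" using assms(1) by (metis add.commute le_Suc_ex)
  obtain F where F: "\<And>x. (F has_real_derivative (x - 1) ^ q * (exp t - x) ^ r) (at x)"
    "F (exp t) - F 1 = (exp t - 1) ^ (q + r + 1) * fact q * fact r / fact (q + r + 1)"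
    using beta_antiderivative[of 1 q "exp t" r] by blast
  \<comment> \<open>\<open>C\<close> collects the factor \<open>m - 1\<close> of the density and the
    powers of \<open>exp (- t)\<close>. The powers of \<open>exp s\<close> cancel except for one,
    the derivative of the substitution \<open>x = exp s\<close>.\<close>
  define C where "C = real (q + 1) * exp (- t) ^ (m + r)"
  let ?f = "\<lambda>s. C * ((exp s - 1) ^ q * (exp t - exp s) ^ r * exp s)"
  have "(\<integral>\<^sup>+s. ennreal (yule_density (m - 1) s * (exp (- (t - s)) ^ m * (1 - exp (- (t - s))) ^ r)) *
      indicator {..t} s \<partial>lborel) = (\<integral>\<^sup>+s. ennreal (?f s) * indicator {0..t} s \<partial>lborel)"
  proof (rule nn_integral_cong)
    fix s
    show "ennreal (yule_density (m - 1) s * (exp (- (t - s)) ^ m * (1 - exp (- (t - s))) ^ r)) *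
      indicator {..t} s = ennreal (?f s) * indicator {0..t} s"
    proof (cases "s \<in> {0..t}")
      case True
      define a b where "a = exp s" and "b = exp (- t)"
      have ab: "a > 0" "b > 0" "exp (- s) = 1 / a" "exp t = 1 / b" "exp (- (t - s)) = b * a"
        by (simp_all add: a_def b_def exp_minus inverse_eq_divide exp_diff)
      have "1 - 1 / a = (a - 1) / a" "1 - b * a = b * (1 / b - a)"
        using ab(1,2) by (simp_all add: field_simps)
      then have 1: "(1 - 1 / a) ^ q = (a - 1) ^ q / a ^ q" and 2: "(1 - b * a) ^ r = b ^ r * (1 / b - a) ^ r"
        by (simp_all only: power_divide power_mult_distrib)
      have "yule_density (m - 1) s * (exp (- (t - s)) ^ m * (1 - exp (- (t - s))) ^ r) =
          real (q + 1) * (1 / a) * (1 - 1 / a) ^ q * ((b * a) ^ m * (1 - b * a) ^ r)"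
        using True unfolding ab(5) by (simp add: yule_density_def m ab(3))
      also have "\<dots> = real (q + 1) * b ^ (m + r) * ((a - 1) ^ q * (1 / b - a) ^ r * a)"
        unfolding 1 2 using ab(1,2) by (simp add: m field_simps power_add power_mult_distrib)
      also have "\<dots> = ?f s"
        by (simp add: C_def ab(4)) (simp add: a_def b_def)
      finally show ?thesis using True by simp
    next
      case False
      then show ?thesis by (auto simp: yule_density_def indicator_def)
    qed
  qed
  also have "\<dots> = ennreal (C * F (exp t) - C * F (exp 0))"
  proof (rule nn_integral_FTC_Icc[where F = "\<lambda>s. C * F (exp s)"])
    show "((\<lambda>s. C * F (exp s)) has_real_derivative ?f s) (at s)" for s
      by (intro DERIV_cmult DERIV_chain2[OF F(1)] DERIV_exp)
    show "0 \<le> ?f s" if "s \<in> {0..t}" for s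
      using that by (simp add: C_def)
  qed (use assms in auto)
  also have "C * F (exp t) - C * F (exp 0) =
      C * ((exp t - 1) ^ (q + r + 1) * fact q * fact r / fact (q + r + 1))"
    unfolding F(2)[symmetric] right_diff_distrib exp_zero ..
  also have "\<dots> = exp (- t) * (exp (- t) * (exp t - 1)) ^ (q + r + 1) *
      (fact (q + 1) * fact r / fact (q + r + 1))"
  proof -
    have "C = real (q + 1) * (exp (- t) * exp (- t) ^ (q + r + 1))"
      by (simp add: C_def m)
    moreover have "fact (q + 1) = real (q + 1) * fact q" by simp
    ultimately show ?thesis
      by (simp only: power_mult_distrib times_divide_eq_right times_divide_eq_left mult_ac)
  qed
  also have "exp (- t) * (exp t - 1) = 1 - exp (- t)"
    by (simp add: algebra_simps exp_add[symmetric])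
  also have "fact (q + 1) * fact r / fact (q + r + 1) = 1 / real ((m - 1 + r) choose (m - 1))"
    by (simp add: m binomial_fact add_ac del: binomial_Suc_Suc)
  finally show ?thesis by (simp add: m add_ac)
qed

text \<open>With \<open>u = 1 - exp (- t)\<close> this is the integral of
  \<open>u ^ k * (1 - u)\<close> from 0 to 1, that is
  \<open>1 / (k + 1) - 1 / (k + 2)\<close>.\<close>

lemma nn_integral_exponential_yule:
  "(\<integral>\<^sup>+t. ennreal (exponential_density 1 t * (exp (- t) * (1 - exp (- t)) ^ k)) \<partial>lborel) =
    ennreal (1 / ((real k + 1) * (real k + 2)))"
proof -
  let ?f = "\<lambda>t. exp (- t) * (exp (- t) * (1 - exp (- t)) ^ k) :: real"
  let ?F = "\<lambda>t. (1 - exp (- t)) ^ (k + 1) / (k + 1) - (1 - exp (- t)) ^ (k + 2) / (k + 2) :: real"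
  have "(\<integral>\<^sup>+t. ennreal (exponential_density 1 t * (exp (- t) * (1 - exp (- t)) ^ k)) \<partial>lborel) =
      (\<integral>\<^sup>+t. ennreal (?f t) * indicator {0..} t \<partial>lborel)"
    by (intro nn_integral_cong) (auto simp: exponential_density_def indicator_def)
  also have "\<dots> = ennreal ((1 / (k + 1) - 1 / (k + 2)) - ?F 0)"
  proof (rule nn_integral_FTC_atLeast[where F = ?F])
    fix t :: real assume "0 \<le> t"
    have "(?F has_real_derivative (1 - exp (- t)) ^ k * exp (- t) - (1 - exp (- t)) ^ (k + 1) * exp (- t)) (at t)"
      by (rule derivative_eq_intros refl | simp del: power_Suc of_nat_Suc)+
    also have "(1 - exp (- t)) ^ k * exp (- t) - (1 - exp (- t)) ^ (k + 1) * exp (- t) = ?f t"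
      by (simp add: algebra_simps)
    finally show "(?F has_real_derivative ?f t) (at t)" .
  next
    have "((\<lambda>t::real. exp (- t)) \<longlongrightarrow> 0) at_top"
      by (rule filterlim_compose[OF exp_at_bot filterlim_uminus_at_bot_at_top])
    then have "(?F \<longlongrightarrow> (1 - 0) ^ (k + 1) / (k + 1) - (1 - 0) ^ (k + 2) / (k + 2)) at_top"
      by (intro tendsto_intros) auto
    then show "(?F \<longlongrightarrow> 1 / (k + 1) - 1 / (k + 2)) at_top" by simp
  qed auto
  also have "(1 / (k + 1) - 1 / (k + 2)) - ?F 0 = 1 / ((real k + 1) * (real k + 2))"
    by (simp add: divide_simps) (simp add: algebra_simps)
  finally show ?thesis .
qed

subsection \<open>Recursive structure of the family tree\<close>

text \<open>The time is allowed to vary along with the waiting times, because the time left to the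
  subtrees after the root has split is itself random.\<close>

lemma measurable_family_tree:
  fixes Y :: "'b \<Rightarrow> nat list \<Rightarrow> nat \<Rightarrow> real"
  assumes Y: "\<And>u i. u \<in> lists {1..m} \<Longrightarrow> i \<in> {1..m-1} \<Longrightarrow> (\<lambda>x. Y x u i) \<in> borel_measurable N"
    and t [measurable]: "t \<in> borel_measurable N"
  shows "(\<lambda>x. family_tree m (Y x) (t x)) \<in> measurable N tree_space"
proof -
  have "(\<lambda>x. family_tree m (Y x) (t x) u) \<in> measurable N (count_space UNIV)" for u
  proof (cases "u \<in> lists {1..m}")
    case True
    then have take: "take j u \<in> lists {1..m}" for j
      by (auto dest: in_set_takeD)
    have [measurable]: "(\<lambda>x. birth_time m (Y x) u) \<in> borel_measurable N"
      unfolding birth_time_def by (intro borel_measurable_sum Y take)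
    have "Measurable.pred N (\<lambda>x. birth_time m (Y x) u + (\<Sum>j=1..i. Y x u j) \<le> t x)"
      if "i \<in> {1..m-1}" for i
    proof -
      have [measurable]: "(\<lambda>x. \<Sum>j=1..i. Y x u j) \<in> borel_measurable N"
        using that True by (intro borel_measurable_sum Y) auto
      show ?thesis by measurable
    qed
    then have filter: "(\<lambda>x. card (set (filter (\<lambda>i. birth_time m (Y x) u + (\<Sum>j=1..i. Y x u j) \<le> t x)
        [1..<Suc (m - 1)]))) \<in> measurable N (count_space UNIV)"
      by (intro measurable_compose[OF filter_measurable_count_space, where g = "\<lambda>js. card (set js)"]) auto
    have "keys_at m (Y x) (t x) u = card (set (filter (\<lambda>i. birth_time m (Y x) u + (\<Sum>j=1..i. Y x u j) \<le> t x)
        [1..<Suc (m - 1)]))" for x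
      unfolding keys_at_def by (auto intro!: arg_cong[where f = card])
    then have [measurable]: "(\<lambda>x. keys_at m (Y x) (t x) u) \<in> measurable N (count_space UNIV)"
      using filter by (simp only:)
    show ?thesis using True unfolding family_tree_def by simp
  qed (simp add: family_tree_def)
  then show ?thesis
    unfolding tree_space_def by (intro measurable_PiM_single') auto
qed

text \<open>There are only countably many addresses, so prescribing all labels is a countable
  intersection of measurable conditions.\<close>

lemma singleton_sets_tree_space [measurable]: "{T} \<in> sets tree_space"
proof -
  have "(\<Pi>\<^sub>E u\<in>UNIV. {T u}) \<in> sets tree_space"
    unfolding tree_space_def by (intro sets_PiM_I_countable) auto
  also have "(\<Pi>\<^sub>E u\<in>UNIV. {T u}) = {T}"
    by (auto simp: PiE_UNIV_domain fun_eq_iff)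
  finally show ?thesis .
qed

lemma space_tree_space [simp]: "space tree_space = UNIV"
  by (simp add: tree_space_def space_PiM)

lemma pred_eq_tree:
  assumes "f \<in> measurable N tree_space"
  shows "Measurable.pred N (\<lambda>x. f x = T)"
  using measurable_sets[OF assms singleton_sets_tree_space[of T]]
  by (simp add: pred_def vimage_def Int_def conj_commute)

text \<open>Lets waiting times be replaced by their restrictions to blocks of indices, which have
  arbitrary values elsewhere; independence is stated for such restrictions.\<close>

lemma family_tree_cong:
  assumes "\<And>u i. u \<in> lists {1..m} \<Longrightarrow> i \<in> {1..m-1} \<Longrightarrow> y u i = z u i"
  shows "family_tree m y t = family_tree m z t"
proof
  fix u
  show "family_tree m y t u = family_tree m z t u"
  proof (cases "u \<in> lists {1..m}")
    case True
    then have "take j u \<in> lists {1..m}" for j by (auto dest: in_set_takeD)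
    then have "birth_time m y u = birth_time m z u"
      unfolding birth_time_def by (intro sum.cong assms) auto
    moreover have "(\<Sum>j=1..i. y u j) = (\<Sum>j=1..i. z u j)" if "i \<in> {1..m-1}" for i
      using that True by (intro sum.cong assms) auto
    ultimately have "keys_at m y t u = keys_at m z t u"
      unfolding keys_at_def by (intro arg_cong[where f = card]) auto
    then show ?thesis
      using \<open>birth_time m y u = birth_time m z u\<close> by (simp add: family_tree_def)
  qed (simp add: family_tree_def)
qed

lemma birth_time_Cons:
  "birth_time m y (j # u) = (\<Sum>i=1..m-1. y [] i) + birth_time m (\<lambda>u. y (j # u)) u"
  unfolding birth_time_def by (simp add: sum.lessThan_Suc_shift del: sum.lessThan_Suc)

text \<open>The branching property for a single realisation: below child \<open>j\<close> runs the
  same process with shifted waiting times, for the time that remains after the root has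
  split.\<close>

lemma family_tree_Cons:
  "family_tree m y t (j # u) =
    (if j \<in> {1..m} then family_tree m (\<lambda>u. y (j # u)) (t - (\<Sum>i=1..m-1. y [] i)) u else None)"
  by (auto simp: family_tree_def keys_at_def birth_time_Cons algebra_simps
      intro!: arg_cong[where f = card])

lemma family_tree_Nil:
  "family_tree m y t [] = (if 0 \<le> t then Some (card {i \<in> {1..m-1}. (\<Sum>j=1..i. y [] j) \<le> t}) else None)"
  by (simp add: family_tree_def keys_at_def birth_time_def)

text \<open>Positive waiting times make the partial sums increase, so the keys acquired by time
  \<open>t\<close> form an initial segment. For \<open>n = q\<close> there is no next key and hence
  no upper bound on \<open>t\<close>.\<close>

lemma card_partial_sums_eq_iff:
  fixes y :: "nat \<Rightarrow> real"
  assumes y: "\<And>i. i \<in> {1..q} \<Longrightarrow> 0 < y i" and "t \<ge> 0" and n: "n \<le> q"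
  shows "card {i \<in> {1..q}. (\<Sum>j=1..i. y j) \<le> t} = n \<longleftrightarrow>
    (\<Sum>j=1..n. y j) \<le> t \<and> (n < q \<longrightarrow> t < (\<Sum>j=1..n+1. y j))"
proof -
  let ?S = "\<lambda>i. \<Sum>j=1..i. y j"
  let ?J = "{i \<in> {1..q}. ?S i \<le> t}"
  have mono: "?S i \<le> ?S k" if "i \<le> k" "k \<le> q" for i k
    using that y by (intro sum_mono2) (auto intro: less_imp_le)
  have "?J = {1..k} \<and> k \<le> q" if "?S k \<le> t" "k \<le> q" "k < q \<Longrightarrow> t < ?S (k + 1)" for k
  proof -
    have "i \<le> k" if "i \<in> ?J" for i
    proof (rule ccontr)
      assume "\<not> i \<le> k"
      then have "k < q" "k + 1 \<le> i" "i \<le> q" using that by auto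
      then have "?S (k + 1) \<le> ?S i" by (intro mono)
      then show False using \<open>k < q \<Longrightarrow> t < ?S (k + 1)\<close> \<open>k < q\<close> that by auto
    qed
    moreover have "?S i \<le> t" if "i \<le> k" for i
      using mono[OF that \<open>k \<le> q\<close>] \<open>?S k \<le> t\<close> by linarith
    ultimately show ?thesis using \<open>k \<le> q\<close> by auto
  qed
  note J = this
  show ?thesis
  proof
    assume "?S n \<le> t \<and> (n < q \<longrightarrow> t < ?S (n + 1))"
    then show "card ?J = n" using J[of n] n by auto
  next
    assume card: "card ?J = n"
    \<comment> \<open>Inserting 0 covers the case in which no key has arrived yet.\<close>
    define k where "k = Max (insert 0 ?J)"
    have k: "k \<in> insert 0 ?J" and max: "\<And>i. i \<in> ?J \<Longrightarrow> i \<le> k"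
      unfolding k_def by (rule Max_in) (auto intro: Max_ge)
    have "?S k \<le> t" "k \<le> q" using k \<open>t \<ge> 0\<close> by auto
    moreover have "t < ?S (k + 1)" if "k < q"
      using max[of "k + 1"] that by (cases "?S (k + 1) \<le> t") auto
    moreover have "k = n" using J[of k] calculation card by auto
    ultimately show "?S n \<le> t \<and> (n < q \<longrightarrow> t < ?S (n + 1))" by auto
  qed
qed

lemma birth_time_nonneg:
  assumes "\<And>u i. u \<in> lists {1..m} \<Longrightarrow> i \<in> {1..m-1} \<Longrightarrow> 0 < y u i" "u \<in> lists {1..m}"
  shows "birth_time m y u \<ge> 0"
  unfolding birth_time_def using assms
  by (intro sum_nonneg) (auto intro!: less_imp_le dest: in_set_takeD)

lemma family_tree_eq_leaf_iff:
  assumes y: "\<And>u i. u \<in> lists {1..m} \<Longrightarrow> i \<in> {1..m-1} \<Longrightarrow> 0 < y u i"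
    and "t \<ge> 0" "n < m - 1"
  shows "family_tree m y t = [[] \<mapsto> n] \<longleftrightarrow>
    (\<Sum>j=1..n. y [] j) \<le> t \<and> t < (\<Sum>j=1..n+1. y [] j)"
proof -
  let ?S = "\<lambda>i. \<Sum>j=1..i. y [] j"
  have root: "family_tree m y t [] = Some n \<longleftrightarrow> ?S n \<le> t \<and> t < ?S (n + 1)"
    using card_partial_sums_eq_iff[of "m - 1" "y []" t n] assms by (simp add: family_tree_Nil)
  \<comment> \<open>Since \<open>n + 1 \<le> m - 1\<close>, the root has not split by time
    \<open>t\<close>, and all other individuals are born later.\<close>
  have none: "family_tree m y t (j # u) = None" if "t < ?S (n + 1)" for j u
  proof (cases "j \<in> {1..m} \<and> u \<in> lists {1..m}")
    case True
    have "?S (n + 1) \<le> ?S (m - 1)"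
      using \<open>n < m - 1\<close> y[of "[]"] by (intro sum_mono2) (auto intro!: less_imp_le)
    moreover have "birth_time m (\<lambda>u. y (j # u)) u \<ge> 0"
      using True by (intro birth_time_nonneg y) auto
    ultimately have "\<not> birth_time m (\<lambda>u. y (j # u)) u \<le> t - ?S (m - 1)"
      using that by linarith
    then show ?thesis unfolding family_tree_Cons by (simp add: family_tree_def)
  next
    case False
    then show ?thesis by (auto simp: family_tree_def)
  qed
  show ?thesis
  proof
    assume "family_tree m y t = [[] \<mapsto> n]"
    then show "?S n \<le> t \<and> t < ?S (n + 1)" using root by simp
  next
    assume S: "?S n \<le> t \<and> t < ?S (n + 1)"
    show "family_tree m y t = [[] \<mapsto> n]"
    proof
      fix u show "family_tree m y t u = [[] \<mapsto> n] u"
        using root none S by (cases u) auto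
    qed
  qed
qed

lemma family_tree_eq_full_iff:
  assumes y: "\<And>i. i \<in> {1..m-1} \<Longrightarrow> 0 < y [] i"
    and "t \<ge> 0" "m - 1 \<le> length xs"
  shows "family_tree m y t = search_tree m xs \<longleftrightarrow> (\<Sum>j=1..m-1. y [] j) \<le> t \<and>
    (\<forall>i<m. family_tree m (\<lambda>u. y (Suc i # u)) (t - (\<Sum>j=1..m-1. y [] j)) = search_tree m (subkeys m xs i))"
proof -
  let ?S = "\<Sum>j=1..m-1. y [] j"
  have root: "family_tree m y t [] = search_tree m xs [] \<longleftrightarrow> ?S \<le> t"
    using card_partial_sums_eq_iff[of "m - 1" "y []" t "m - 1"] assms by (simp add: family_tree_Nil)
  have child: "family_tree m y t (Suc i # u) = search_tree m xs (Suc i # u) \<longleftrightarrow>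
      family_tree m (\<lambda>u. y (Suc i # u)) (t - ?S) u = search_tree m (subkeys m xs i) u" if "i < m" for i u
    using search_tree_Suc[OF assms(3) that] that by (simp add: family_tree_Cons)
  have outside: "family_tree m y t (j # u) = search_tree m xs (j # u)" if "j \<notin> {1..m}" for j u
    using search_tree_outside[OF that] that by (auto simp: family_tree_Cons)
  show ?thesis
  proof (intro iffI conjI allI impI; (elim conjE)?)
    assume "family_tree m y t = search_tree m xs"
    then show "?S \<le> t" using root by simp
  next
    fix i assume "family_tree m y t = search_tree m xs" "i < m"
    then show "family_tree m (\<lambda>u. y (Suc i # u)) (t - ?S) = search_tree m (subkeys m xs i)"
      using child by auto
  next
    assume *: "?S \<le> t" "\<forall>i<m. family_tree m (\<lambda>u. y (Suc i # u)) (t - ?S) = search_tree m (subkeys m xs i)"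
    show "family_tree m y t = search_tree m xs"
    proof
      fix v
      show "family_tree m y t v = search_tree m xs v"
      proof (cases v)
        case Nil
        then show ?thesis using root *(1) by simp
      next
        case (Cons j u)
        show ?thesis
        proof (cases "j \<in> {1..m}")
          case True
          then obtain i where "j = Suc i" "i < m" by (cases j) auto
          then show ?thesis using Cons child *(2) by simp
        next
          case False
          then show ?thesis using Cons outside by simp
        qed
      qed
    qed
  qed
qed

subsection \<open>Waiting times\<close>

lemma (in prob_space) indep_vars_reindex:
  assumes "indep_vars N X I" "inj_on h J" "h ` J \<subseteq> I"
  shows "indep_vars (\<lambda>j. N (h j)) (\<lambda>j. X (h j)) J"
proof -
  have "indep_vars (\<lambda>j. PiM {h j} N) (\<lambda>j \<omega>. restrict (\<lambda>i. X i \<omega>) {h j}) J"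
    using assms by (intro indep_vars_restrict) (auto simp: disjoint_family_on_def inj_on_def)
  then have "indep_vars (\<lambda>j. N (h j)) (\<lambda>j \<omega>. restrict (\<lambda>i. X i \<omega>) {h j} (h j)) J"
    by (rule indep_vars_compose2[where Y = "\<lambda>j f. f (h j)"]) auto
  then show ?thesis by simp
qed

lemma (in prob_space) emeasure_indep_pair:
  assumes ind: "indep_var S X T Z"
    and Q: "Measurable.pred (S \<Otimes>\<^sub>M T) (\<lambda>p. Q (fst p) (snd p))"
  shows "emeasure M {\<omega> \<in> space M. Q (X \<omega>) (Z \<omega>)} =
    (\<integral>\<^sup>+x. emeasure M {\<omega> \<in> space M. Q x (Z \<omega>)} \<partial>distr M S X)"
proof -
  have X [measurable]: "X \<in> measurable M S" and Z [measurable]: "Z \<in> measurable M T"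
    and joint: "distr M S X \<Otimes>\<^sub>M distr M T Z = distr M (S \<Otimes>\<^sub>M T) (\<lambda>\<omega>. (X \<omega>, Z \<omega>))"
    using ind by (auto simp: indep_var_distribution_eq)
  interpret Z: prob_space "distr M T Z" by (rule prob_space_distr) fact
  let ?A = "{p \<in> space (S \<Otimes>\<^sub>M T). Q (fst p) (snd p)}"
  have A: "?A \<in> sets (S \<Otimes>\<^sub>M T)" using Q by (simp add: pred_def)
  have "emeasure M {\<omega> \<in> space M. Q (X \<omega>) (Z \<omega>)} = emeasure (distr M S X \<Otimes>\<^sub>M distr M T Z) ?A"
    unfolding joint using A measurable_space[OF X] measurable_space[OF Z]
    by (subst emeasure_distr) (auto intro!: arg_cong2[where f = emeasure] simp: space_pair_measure)
  also have "\<dots> = (\<integral>\<^sup>+x. emeasure (distr M T Z) (Pair x -` ?A) \<partial>distr M S X)"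
    using A by (intro Z.emeasure_pair_measure_alt) (simp cong: sets_pair_measure_cong)
  also have "\<dots> = (\<integral>\<^sup>+x. emeasure M {\<omega> \<in> space M. Q x (Z \<omega>)} \<partial>distr M S X)"
  proof (rule nn_integral_cong)
    fix x assume "x \<in> space (distr M S X)"
    then have "x \<in> space S" by simp
    moreover have "Pair x -` ?A \<in> sets T" using A by (rule sets_Pair1)
    ultimately show "emeasure (distr M T Z) (Pair x -` ?A) = emeasure M {\<omega> \<in> space M. Q x (Z \<omega>)}"
      using measurable_space[OF Z]
      by (subst emeasure_distr) (auto intro!: arg_cong2[where f = emeasure] simp: space_pair_measure)
  qed
  finally show ?thesis .
qed

lemma measurable_emeasure_section:
  assumes "finite_measure M" and Z: "Z \<in> measurable M T"
    and Q: "Measurable.pred (S \<Otimes>\<^sub>M T) (\<lambda>p. Q (fst p) (snd p))"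
  shows "(\<lambda>x. emeasure M {\<omega> \<in> space M. Q x (Z \<omega>)}) \<in> borel_measurable S"
proof -
  interpret Z: finite_measure "distr M T Z"
    using assms(1) Z by (rule finite_measure.finite_measure_distr)
  let ?A = "{p \<in> space (S \<Otimes>\<^sub>M T). Q (fst p) (snd p)}"
  have A: "?A \<in> sets (S \<Otimes>\<^sub>M T)" using Q by (simp add: pred_def)
  then have "(\<lambda>x. emeasure (distr M T Z) (Pair x -` ?A)) \<in> borel_measurable S"
    by (intro Z.measurable_emeasure_Pair) (simp cong: sets_pair_measure_cong)
  moreover have "emeasure (distr M T Z) (Pair x -` ?A) = emeasure M {\<omega> \<in> space M. Q x (Z \<omega>)}"
    if "x \<in> space S" for x
    using that measurable_space[OF Z] sets_Pair1[OF A, of x]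
    by (subst emeasure_distr[OF Z]) (auto intro!: arg_cong2[where f = emeasure] simp: space_pair_measure)
  ultimately show ?thesis by (simp cong: measurable_cong)
qed

text \<open>Conditioning on one real function \<open>g\<close> of an independent block: the block
  itself need not have a density. It is applied to the root's splitting time and to the stopping
  time.\<close>

lemma (in prob_space) emeasure_indep_distributed:
  assumes ind: "indep_var S X T Z" and g: "g \<in> borel_measurable S"
    and f: "distributed M lborel (\<lambda>\<omega>. g (X \<omega>)) f"
    and Q: "Measurable.pred (borel \<Otimes>\<^sub>M T) (\<lambda>p. Q (fst p) (snd p))"
  shows "emeasure M {\<omega> \<in> space M. Q (g (X \<omega>)) (Z \<omega>)} =
    (\<integral>\<^sup>+x. f x * emeasure M {\<omega> \<in> space M. Q x (Z \<omega>)} \<partial>lborel)"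
proof -
  have X: "X \<in> measurable M S" and Z: "Z \<in> measurable M T"
    using ind by (auto dest: indep_var_rv1 indep_var_rv2)
  note meas = measurable_emeasure_section[OF finite_measure_axioms Z Q]
  have "(\<lambda>p. (g (fst p), snd p)) \<in> measurable (S \<Otimes>\<^sub>M T) (borel \<Otimes>\<^sub>M T)"
    using g by measurable
  from measurable_compose[OF this Q]
  have "emeasure M {\<omega> \<in> space M. Q (g (X \<omega>)) (Z \<omega>)} =
      (\<integral>\<^sup>+x. emeasure M {\<omega> \<in> space M. Q (g x) (Z \<omega>)} \<partial>distr M S X)"
    by (intro emeasure_indep_pair[OF ind, where Q = "\<lambda>x. Q (g x)"]) simp
  also have "\<dots> = (\<integral>\<^sup>+\<omega>. emeasure M {\<omega>' \<in> space M. Q (g (X \<omega>)) (Z \<omega>')} \<partial>M)"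
    using measurable_compose[OF g meas] by (intro nn_integral_distr[OF X]) simp
  also have "\<dots> = (\<integral>\<^sup>+x. f x * emeasure M {\<omega> \<in> space M. Q x (Z \<omega>)} \<partial>lborel)"
    using meas by (intro distributed_nn_integral[OF f, symmetric]) simp
  finally show ?thesis .
qed

text \<open>The branching process without its stopping time. Unlike
  \<open>stopped_branching_process\<close>, it is inherited by the shifted histories of a child, as
  an induction at fixed times requires.\<close>

definition life_histories :: "'a measure \<Rightarrow> nat \<Rightarrow> (nat list \<Rightarrow> nat \<Rightarrow> 'a \<Rightarrow> real) \<Rightarrow> bool" where
  "life_histories M m Y \<longleftrightarrow>
     prob_space.indep_vars M (\<lambda>_. borel) (\<lambda>p. Y (fst p) (snd p)) (lists {1..m} \<times> {1..m-1}) \<and>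
     (\<forall>u\<in>lists {1..m}. \<forall>i\<in>{1..m-1}.
        distributed M lborel (Y u i) (exponential_density (real i)))"

lemma life_histories_measurable:
  assumes "life_histories M m Y" "u \<in> lists {1..m}" "i \<in> {1..m-1}"
  shows "Y u i \<in> borel_measurable M"
  using assms distributed_measurable[of M lborel "Y u i"] by (fastforce simp: life_histories_def)

lemma (in prob_space) life_histories_child:
  assumes Y: "life_histories M m Y" and j: "j \<in> {1..m}"
  shows "life_histories M m (\<lambda>u. Y (j # u))"
proof -
  have "indep_vars (\<lambda>_. borel) (\<lambda>p. Y (fst (j # fst p, snd p)) (snd (j # fst p, snd p)))
      (lists {1..m} \<times> {1..m-1})"
    by (rule indep_vars_reindex[where h = "\<lambda>p. (j # fst p, snd p)"
        and X = "\<lambda>p. Y (fst p) (snd p)" and N = "\<lambda>_. borel" and I = "lists {1..m} \<times> {1..m-1}"])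
      (use Y j in \<open>auto simp: life_histories_def inj_on_def\<close>)
  then show ?thesis using Y j by (auto simp: life_histories_def)
qed

lemma (in prob_space) AE_life_histories_pos:
  assumes "life_histories M m Y"
  shows "AE \<omega> in M. \<forall>u\<in>lists {1..m}. \<forall>i\<in>{1..m-1}. 0 < Y u i \<omega>"
proof -
  have "AE \<omega> in M. 0 < Y u i \<omega>" if "u \<in> lists {1..m}" "i \<in> {1..m-1}" for u i
  proof -
    have D: "distributed M lborel (Y u i) (exponential_density (real i))"
      using assms that by (auto simp: life_histories_def)
    have [measurable]: "Y u i \<in> borel_measurable M" using life_histories_measurable[OF assms that] .
    have "AE x in lborel. x \<noteq> (0::real)" by (rule AE_lborel_singleton)
    then have "AE x in density lborel (exponential_density (real i)). 0 < x"
      by (subst AE_density) (auto simp: exponential_density_def)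
    then have "AE x in distr M lborel (Y u i). 0 < x"
      by (simp only: distributed_distr_eq_density[OF D])
    then show ?thesis by (subst (asm) AE_distr_iff) auto
  qed
  then show ?thesis by (intro AE_ball_countable[THEN iffD2] ballI countable_lists) auto
qed

lemma (in prob_space) distributed_sum_waiting_times:
  assumes Y: "life_histories M m Y" and u: "u \<in> lists {1..m}" and n: "1 \<le> n" "n \<le> m - 1"
  shows "distributed M lborel (\<lambda>\<omega>. \<Sum>i=1..n. Y u i \<omega>) (yule_density n)"
  using n
proof (induction n rule: nat_induct_at_least)
  case base
  then have "1 \<in> {1..m-1}" by simp
  then have "distributed M lborel (Y u 1) (exponential_density (real 1))"
    using Y u unfolding life_histories_def by blast
  then show ?case by (simp add: yule_density_1[unfolded One_nat_def])
next
  case (Suc n)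
  then have IH: "distributed M lborel (\<lambda>\<omega>. \<Sum>i=1..n. Y u i \<omega>) (yule_density n)"
    and n: "1 \<le> n" "n + 1 \<in> {1..m-1}"
    by auto
  have "indep_vars (\<lambda>_. borel) (\<lambda>i. Y (fst (u, i)) (snd (u, i))) {1..m-1}"
    by (rule indep_vars_reindex[where h = "Pair u" and X = "\<lambda>p. Y (fst p) (snd p)"
        and N = "\<lambda>_. borel" and I = "lists {1..m} \<times> {1..m-1}"])
      (use Y u in \<open>auto simp: life_histories_def inj_on_def\<close>)
  then have "indep_vars (\<lambda>_. borel) (Y u) {1..m-1}" by simp
  then have "indep_var (PiM {1..n} (\<lambda>_. borel)) (\<lambda>\<omega>. restrict (\<lambda>i. Y u i \<omega>) {1..n})
      (PiM {n + 1} (\<lambda>_. borel)) (\<lambda>\<omega>. restrict (\<lambda>i. Y u i \<omega>) {n + 1})"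
    using n by (intro indep_var_restrict) auto
  then have "indep_var borel ((\<lambda>f. \<Sum>i=1..n. f i) \<circ> (\<lambda>\<omega>. restrict (\<lambda>i. Y u i \<omega>) {1..n}))
      borel ((\<lambda>f. f (n + 1)) \<circ> (\<lambda>\<omega>. restrict (\<lambda>i. Y u i \<omega>) {n + 1}))"
    by (rule indep_var_compose) auto
  then have "indep_var borel (\<lambda>\<omega>. \<Sum>i=1..n. Y u i \<omega>) borel (Y u (n + 1))"
    by (simp add: o_def)
  moreover have "distributed M lborel (Y u (n + 1)) (exponential_density (real (n + 1)))"
    using Y u n unfolding life_histories_def by blast
  ultimately have "distributed M lborel (\<lambda>\<omega>. (\<Sum>i=1..n. Y u i \<omega>) + Y u (n + 1) \<omega>)
      (\<lambda>x. \<integral>\<^sup>+y. ennreal (yule_density n (x - y)) * ennreal (exponential_density (real (n + 1)) y) \<partial>lborel)"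
    using IH by (intro distributed_convolution)
  then show ?case
    using n by (simp only: yule_density_convolution) simp
qed

lemma (in prob_space) prob_sum_waiting_times_le:
  assumes Y: "life_histories M m Y" and n: "n \<le> m - 1" and t: "t \<ge> 0"
  shows "prob {\<omega> \<in> space M. (\<Sum>i=1..n. Y [] i \<omega>) \<le> t} = (1 - exp (- t)) ^ n"
proof (cases "n = 0")
  case True
  then show ?thesis using t by (simp add: prob_space)
next
  case False
  then have "distributed M lborel (\<lambda>\<omega>. \<Sum>i=1..n. Y [] i \<omega>) (yule_density n)"
    using n by (intro distributed_sum_waiting_times[OF Y]) auto
  then have "emeasure M ((\<lambda>\<omega>. \<Sum>i=1..n. Y [] i \<omega>) -` {..t} \<inter> space M) = ennreal ((1 - exp (- t)) ^ n)"
    using False t by (subst distributed_emeasure) (auto simp: nn_integral_yule_density_atMost)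
  also have "(\<lambda>\<omega>. \<Sum>i=1..n. Y [] i \<omega>) -` {..t} \<inter> space M = {\<omega> \<in> space M. (\<Sum>i=1..n. Y [] i \<omega>) \<le> t}"
    by auto
  finally show ?thesis using t by (simp add: emeasure_eq_measure)
qed

subsection \<open>The law of the family tree at a fixed time\<close>

lemma measurable_family_tree_life_histories:
  assumes "life_histories M m Y"
  shows "(\<lambda>\<omega>. family_tree m (\<lambda>u i. Y u i \<omega>) t) \<in> measurable M tree_space"
  by (intro measurable_family_tree life_histories_measurable[OF assms]) auto

text \<open>The root has its \<open>n\<close>-th but not its \<open>(n + 1)\<close>-st key, and the
  second event lies in the first up to a null set. The probability is the difference of consecutive
  powers of \<open>1 - exp (- t)\<close>.\<close>

lemma (in prob_space) emeasure_family_tree_leaf: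
  assumes Y: "life_histories M m Y" and t: "t \<ge> 0" and n: "n < m - 1"
  shows "emeasure M {\<omega> \<in> space M. family_tree m (\<lambda>u i. Y u i \<omega>) t = [[] \<mapsto> n]} =
    ennreal (exp (- t) * (1 - exp (- t)) ^ n)"
proof -
  let ?S = "\<lambda>i \<omega>. \<Sum>j=1..i. Y [] j \<omega>"
  let ?E = "{\<omega> \<in> space M. family_tree m (\<lambda>u i. Y u i \<omega>) t = [[] \<mapsto> n]}"
  have S: "?S i \<in> borel_measurable M" if "i \<le> m - 1" for i
    using that by (intro borel_measurable_sum life_histories_measurable[OF Y]) auto
  have "Measurable.pred M (\<lambda>\<omega>. family_tree m (\<lambda>u i. Y u i \<omega>) t = [[] \<mapsto> n])"
    by (rule pred_eq_tree[OF measurable_family_tree_life_histories[OF Y]])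
  then have E: "?E \<in> sets M" by (simp add: pred_def)
  have pos: "AE \<omega> in M. \<forall>u\<in>lists {1..m}. \<forall>i\<in>{1..m-1}. 0 < Y u i \<omega>"
    using Y by (rule AE_life_histories_pos)
  have "AE \<omega> in M. (\<omega> \<in> ?E) \<longleftrightarrow> (\<omega> \<in> {\<omega> \<in> space M. ?S n \<omega> \<le> t} - {\<omega> \<in> space M. ?S (n + 1) \<omega> \<le> t})"
    using pos
  proof (eventually_elim)
    case (elim \<omega>)
    then have "family_tree m (\<lambda>u i. Y u i \<omega>) t = [[] \<mapsto> n] \<longleftrightarrow> ?S n \<omega> \<le> t \<and> t < ?S (n + 1) \<omega>"
      using t n by (intro family_tree_eq_leaf_iff) auto
    then show ?case by auto
  qed
  moreover have le: "{\<omega> \<in> space M. ?S n \<omega> \<le> t} \<in> sets M" "{\<omega> \<in> space M. ?S (n + 1) \<omega> \<le> t} \<in> sets M"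
    using S[of n] S[of "n + 1"] n by (auto intro!: borel_measurable_le simp del: sum.cl_ivl_Suc)
  ultimately have "prob ?E = prob ({\<omega> \<in> space M. ?S n \<omega> \<le> t} - {\<omega> \<in> space M. ?S (n + 1) \<omega> \<le> t})"
    using E by (intro finite_measure_eq_AE sets.Diff)
  also have "\<dots> = prob {\<omega> \<in> space M. ?S n \<omega> \<le> t} -
      prob ({\<omega> \<in> space M. ?S n \<omega> \<le> t} \<inter> {\<omega> \<in> space M. ?S (n + 1) \<omega> \<le> t})"
    using le by (rule finite_measure_Diff')
  also have "prob ({\<omega> \<in> space M. ?S n \<omega> \<le> t} \<inter> {\<omega> \<in> space M. ?S (n + 1) \<omega> \<le> t}) =
      prob {\<omega> \<in> space M. ?S (n + 1) \<omega> \<le> t}"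
  proof (rule finite_measure_eq_AE)
    show "AE \<omega> in M. (\<omega> \<in> {\<omega> \<in> space M. ?S n \<omega> \<le> t} \<inter> {\<omega> \<in> space M. ?S (n + 1) \<omega> \<le> t}) =
        (\<omega> \<in> {\<omega> \<in> space M. ?S (n + 1) \<omega> \<le> t})"
      using pos
    proof eventually_elim
      case (elim \<omega>)
      then have "0 < Y [] (n + 1) \<omega>" using n by auto
      then show ?case by auto
    qed
  qed (use le in auto)
  also have "prob {\<omega> \<in> space M. ?S n \<omega> \<le> t} - prob {\<omega> \<in> space M. ?S (n + 1) \<omega> \<le> t} =
      exp (- t) * (1 - exp (- t)) ^ n"
    using n t by (subst (1 2) prob_sum_waiting_times_le[OF Y]) (auto simp: algebra_simps)
  finally show ?thesis unfolding emeasure_eq_measure by (simp only:)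
qed

text \<open>Subtrees at different positions read disjoint blocks of the independent waiting
  times.\<close>

lemma (in prob_space) prob_child_trees:
  assumes Y: "life_histories M m Y" and m: "m \<ge> 1"
  shows "prob {\<omega> \<in> space M. \<forall>i\<in>{..<m}. family_tree m (\<lambda>u l. Y (Suc i # u) l \<omega>) t = T i} =
    (\<Prod>i<m. prob {\<omega> \<in> space M. family_tree m (\<lambda>u l. Y (Suc i # u) l \<omega>) t = T i})"
proof -
  let ?X = "\<lambda>p. Y (fst p) (snd p)"
  let ?K = "\<lambda>i. {p \<in> lists {1..m} \<times> {1..m-1}. \<exists>u. fst p = Suc i # u}"
  let ?W = "\<lambda>i \<omega>. family_tree m (\<lambda>u l. Y (Suc i # u) l \<omega>) t"
  let ?f = "\<lambda>i z. family_tree m (\<lambda>u l. z (Suc i # u, l)) t"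
  have "indep_vars (\<lambda>i. PiM (?K i) (\<lambda>_. borel)) (\<lambda>i \<omega>. restrict (\<lambda>p. ?X p \<omega>) (?K i)) {..<m}"
    using Y by (intro indep_vars_restrict) (auto simp: life_histories_def disjoint_family_on_def)
  then have "indep_vars (\<lambda>_. tree_space) (\<lambda>i \<omega>. ?f i (restrict (\<lambda>p. ?X p \<omega>) (?K i))) {..<m}"
    by (rule indep_vars_compose2[where Y = ?f])
      (intro measurable_family_tree measurable_component_singleton, auto)
  moreover have "?f i (restrict (\<lambda>p. ?X p \<omega>) (?K i)) = ?W i \<omega>" if "i < m" for i \<omega>
    using that by (intro family_tree_cong) auto
  ultimately have ind: "indep_vars (\<lambda>_. tree_space) ?W {..<m}"
    by (subst indep_vars_cong[OF refl _ refl, where Y = "\<lambda>i \<omega>. ?f i (restrict (\<lambda>p. ?X p \<omega>) (?K i))"])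
      auto
  have ne: "{..<m} \<noteq> {}" using m by (simp add: lessThan_empty_iff)
  have "{\<omega> \<in> space M. \<forall>i\<in>{..<m}. ?W i \<omega> = T i} = (\<Inter>i\<in>{..<m}. ?W i -` {T i} \<inter> space M)"
    using m by (auto simp: lessThan_empty_iff)
  also have "prob \<dots> = (\<Prod>i<m. prob (?W i -` {T i} \<inter> space M))"
    using ne by (intro indep_varsD_finite[OF ind]) auto
  also have "\<dots> = (\<Prod>i<m. prob {\<omega> \<in> space M. ?W i \<omega> = T i})"
    by (intro prod.cong arg_cong[where f = prob]) auto
  finally show ?thesis .
qed

text \<open>A full root has split at some time \<open>s \<le> t\<close>. Conditioning on
  \<open>s\<close> leaves independent subtrees observed for the time \<open>t - s\<close>.\<close>

lemma (in prob_space) emeasure_family_tree_full: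
  assumes Y: "life_histories M m Y" and m: "m \<ge> 2" and t: "t \<ge> 0" and xs: "m - 1 \<le> length xs"
  shows "emeasure M {\<omega> \<in> space M. family_tree m (\<lambda>u i. Y u i \<omega>) t = search_tree m xs} =
    (\<integral>\<^sup>+s. ennreal (yule_density (m - 1) s) * (indicator {..t} s *
      ennreal (\<Prod>i<m. prob {\<omega> \<in> space M.
        family_tree m (\<lambda>u l. Y (Suc i # u) l \<omega>) (t - s) = search_tree m (subkeys m xs i)})) \<partial>lborel)"
proof -
  let ?X = "\<lambda>p. Y (fst p) (snd p)"
  \<comment> \<open>\<open>?A\<close> holds the waiting times of the root, which determine
    \<open>s\<close>; \<open>?B\<close> holds those of everybody else, which determine the
    subtrees.\<close>
  let ?A = "{[]} \<times> {1..m-1}" and ?B = "{p \<in> lists {1..m} \<times> {1..m-1}. fst p \<noteq> []}"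
  let ?S = "\<lambda>\<omega>. \<Sum>j=1..m-1. Y [] j \<omega>" and ?Z = "\<lambda>\<omega>. restrict (\<lambda>p. ?X p \<omega>) ?B"
  let ?g = "\<lambda>f :: nat list \<times> nat \<Rightarrow> real. \<Sum>j=1..m-1. f ([], j)"
  let ?T = "\<lambda>i. search_tree m (subkeys m xs i)"
  let ?child = "\<lambda>i s (z :: nat list \<times> nat \<Rightarrow> real). family_tree m (\<lambda>u l. z (Suc i # u, l)) (t - s)"
  let ?Q = "\<lambda>s z. s \<le> t \<and> (\<forall>i\<in>{..<m}. ?child i s z = ?T i)"
  have ind: "indep_var (PiM ?A (\<lambda>_. borel)) (\<lambda>\<omega>. restrict (\<lambda>p. ?X p \<omega>) ?A) (PiM ?B (\<lambda>_. borel)) ?Z"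
    using Y by (intro indep_var_restrict) (auto simp: life_histories_def)
  have g: "?g (restrict (\<lambda>p. ?X p \<omega>) ?A) = ?S \<omega>" for \<omega>
    by (intro sum.cong) auto
  have S: "distributed M lborel ?S (yule_density (m - 1))"
    using m by (intro distributed_sum_waiting_times[OF Y]) auto
  have child: "(\<lambda>p. ?child i (fst p) (snd p)) \<in>
      measurable (borel \<Otimes>\<^sub>M PiM ?B (\<lambda>_. borel)) tree_space" if "i < m" for i
  proof (rule measurable_family_tree)
    fix u l assume "u \<in> lists {1..m}" "l \<in> {1..m-1}"
    then have [measurable]: "(\<lambda>z. z (Suc i # u, l)) \<in> borel_measurable (PiM ?B (\<lambda>_. borel :: real measure))"
      using that by (intro measurable_component_singleton) auto
    show "(\<lambda>p. snd p (Suc i # u, l)) \<in> borel_measurable (borel \<Otimes>\<^sub>M PiM ?B (\<lambda>_. borel :: real measure))"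
      by measurable
  qed measurable
  have Q: "Measurable.pred (borel \<Otimes>\<^sub>M PiM ?B (\<lambda>_. borel)) (\<lambda>p. ?Q (fst p) (snd p))"
  proof -
    have all [measurable]: "Measurable.pred (borel \<Otimes>\<^sub>M PiM ?B (\<lambda>_. borel))
        (\<lambda>p. \<forall>i\<in>{..<m}. ?child i (fst p) (snd p) = ?T i)"
    proof (rule pred_intros_finite)
      fix i assume "i \<in> {..<m}"
      then show "Measurable.pred (borel \<Otimes>\<^sub>M PiM ?B (\<lambda>_. borel)) (\<lambda>p. ?child i (fst p) (snd p) = ?T i)"
        by (intro pred_eq_tree child) simp
    qed simp
    show ?thesis by measurable
  qed
  have restrict: "?child i s (?Z \<omega>) = family_tree m (\<lambda>u l. Y (Suc i # u) l \<omega>) (t - s)"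
    if "i < m" for i s \<omega>
    using that by (intro family_tree_cong) auto
  have "emeasure M {\<omega> \<in> space M. family_tree m (\<lambda>u i. Y u i \<omega>) t = search_tree m xs} =
      emeasure M {\<omega> \<in> space M. ?Q (?S \<omega>) (?Z \<omega>)}"
  proof (rule emeasure_eq_AE)
    show "AE \<omega> in M. (\<omega> \<in> {\<omega> \<in> space M. family_tree m (\<lambda>u i. Y u i \<omega>) t = search_tree m xs}) =
        (\<omega> \<in> {\<omega> \<in> space M. ?Q (?S \<omega>) (?Z \<omega>)})"
      using AE_life_histories_pos[OF Y]
    proof eventually_elim
      case (elim \<omega>)
      then have "family_tree m (\<lambda>u i. Y u i \<omega>) t = search_tree m xs \<longleftrightarrow> ?Q (?S \<omega>) (?Z \<omega>)"
        using t xs restrict by (subst family_tree_eq_full_iff) auto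
      then show ?case by simp
    qed
    have "Measurable.pred M (\<lambda>\<omega>. family_tree m (\<lambda>u i. Y u i \<omega>) t = search_tree m xs)"
      by (rule pred_eq_tree[OF measurable_family_tree_life_histories[OF Y]])
    then show "{\<omega> \<in> space M. family_tree m (\<lambda>u i. Y u i \<omega>) t = search_tree m xs} \<in> sets M"
      by (simp add: pred_def)
    have "(\<lambda>\<omega>. (?S \<omega>, ?Z \<omega>)) \<in> measurable M (borel \<Otimes>\<^sub>M PiM ?B (\<lambda>_. borel))"
      using indep_var_rv2[OF ind] distributed_measurable[OF S] by (intro measurable_Pair) auto
    from measurable_compose[OF this Q] show "{\<omega> \<in> space M. ?Q (?S \<omega>) (?Z \<omega>)} \<in> sets M"
      by (simp add: pred_def)
  qed
  also have "\<dots> = emeasure M {\<omega> \<in> space M. ?Q (?g (restrict (\<lambda>p. ?X p \<omega>) ?A)) (?Z \<omega>)}"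
    by (simp only: g)
  also have "\<dots> = (\<integral>\<^sup>+s. yule_density (m - 1) s * emeasure M {\<omega> \<in> space M. ?Q s (?Z \<omega>)} \<partial>lborel)"
    by (rule emeasure_indep_distributed[OF ind, where Q = ?Q]) (use S Q g in auto)
  also have "\<dots> = (\<integral>\<^sup>+s. ennreal (yule_density (m - 1) s) * (indicator {..t} s *
      ennreal (\<Prod>i<m. prob {\<omega> \<in> space M. family_tree m (\<lambda>u l. Y (Suc i # u) l \<omega>) (t - s) = ?T i})) \<partial>lborel)"
  proof (intro nn_integral_cong arg_cong2[where f = "(*)"] refl)
    fix s :: real
    have "emeasure M {\<omega> \<in> space M. ?Q s (?Z \<omega>)} = indicator {..t} s *
        ennreal (prob {\<omega> \<in> space M. \<forall>i\<in>{..<m}. family_tree m (\<lambda>u l. Y (Suc i # u) l \<omega>) (t - s) = ?T i})"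
      using restrict by (auto simp: emeasure_eq_measure indicator_def cong: conj_cong imp_cong)
    then show "emeasure M {\<omega> \<in> space M. ?Q s (?Z \<omega>)} = indicator {..t} s *
        ennreal (\<Prod>i<m. prob {\<omega> \<in> space M. family_tree m (\<lambda>u l. Y (Suc i # u) l \<omega>) (t - s) = ?T i})"
      using m by (subst prob_child_trees[OF Y, symmetric]) auto
  qed
  finally show ?thesis .
qed

text \<open>Histories and time are generalised in the induction, since a subtree uses shifted
  histories and time \<open>t - s\<close>. The binomial coefficient from the integral is the one in
  \<open>search_prob_rec\<close>.\<close>

lemma (in prob_space) emeasure_family_tree_eq_search_tree:
  assumes "m \<ge> 2" "life_histories M m Y" "distinct xs" "t \<ge> 0"
  shows "emeasure M {\<omega> \<in> space M. family_tree m (\<lambda>u i. Y u i \<omega>) t = search_tree m xs} =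
    ennreal (search_prob m (length xs) (search_tree m xs) * (exp (- t) * (1 - exp (- t)) ^ length xs))"
  using assms(2-)
proof (induction xs arbitrary: Y t rule: length_induct)
  case (1 xs)
  note Y = 1(2) and xs = 1(3) and t = 1(4)
  show ?case
  proof (cases "length xs < m - 1")
    case True
    then show ?thesis
      using emeasure_family_tree_leaf[OF Y t True] search_prob_short[OF True]
      by (simp only: search_tree_short) simp
  next
    case False
    then have len: "m - 1 \<le> length xs" by simp
    let ?T = "\<lambda>i. search_tree m (subkeys m xs i)"
    let ?P = "\<Prod>i<m. search_prob m (length (subkeys m xs i)) (?T i)"
    define r where "r = (\<Sum>i<m. length (subkeys m xs i))"
    have len_eq: "length xs = m - 1 + r"
      using sum_length_subkeys[of m xs] assms(1) len by (simp add: r_def)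
    let ?g = "\<lambda>s. exp (- (t - s)) ^ m * (1 - exp (- (t - s))) ^ r"
    have prod: "(\<Prod>i<m. prob {\<omega> \<in> space M. family_tree m (\<lambda>u l. Y (Suc i # u) l \<omega>) (t - s) = ?T i}) =
        ?P * ?g s" if "s \<le> t" for s
    proof -
      have "prob {\<omega> \<in> space M. family_tree m (\<lambda>u l. Y (Suc i # u) l \<omega>) (t - s) = ?T i} =
          search_prob m (length (subkeys m xs i)) (?T i) *
            (exp (- (t - s)) * (1 - exp (- (t - s))) ^ length (subkeys m xs i))" if "i < m" for i
      proof -
        have "life_histories M m (\<lambda>u. Y (Suc i # u))"
          using that by (intro life_histories_child[OF Y]) auto
        then have "emeasure M {\<omega> \<in> space M. family_tree m (\<lambda>u l. Y (Suc i # u) l \<omega>) (t - s) = ?T i} =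
          ennreal (search_prob m (length (subkeys m xs i)) (?T i) *
            (exp (- (t - s)) * (1 - exp (- (t - s))) ^ length (subkeys m xs i)))"
          using 1(1) length_subkeys_less[OF assms(1) len] distinct_subkeys[OF xs] \<open>s \<le> t\<close> by simp
        then show ?thesis
          using \<open>s \<le> t\<close> by (simp add: emeasure_eq_measure search_prob_nonneg)
      qed
      then show ?thesis
        by (simp add: prod.distrib power_sum r_def)
    qed
    have P: "?P \<ge> 0" by (intro prod_nonneg search_prob_nonneg)
    have "emeasure M {\<omega> \<in> space M. family_tree m (\<lambda>u i. Y u i \<omega>) t = search_tree m xs} =
        (\<integral>\<^sup>+s. ennreal ?P * (ennreal (yule_density (m - 1) s * ?g s) * indicator {..t} s) \<partial>lborel)"
      unfolding emeasure_family_tree_full[OF Y assms(1) t len]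
    proof (intro nn_integral_cong)
      fix s
      show "ennreal (yule_density (m - 1) s) * (indicator {..t} s *
          ennreal (\<Prod>i<m. prob {\<omega> \<in> space M. family_tree m (\<lambda>u l. Y (Suc i # u) l \<omega>) (t - s) = ?T i})) =
        ennreal ?P * (ennreal (yule_density (m - 1) s * ?g s) * indicator {..t} s)"
        using P by (cases "s \<le> t")
          (simp_all add: prod ennreal_mult ennreal_mult' yule_density_nonneg mult_ac)
    qed
    also have "\<dots> = ennreal ?P * ennreal (exp (- t) * (1 - exp (- t)) ^ (m - 1 + r) / ((m - 1 + r) choose (m - 1)))"
      using assms(1) t by (subst nn_integral_cmult) (simp_all only: nn_integral_yule_density_split, measurable)
    also have "\<dots> = ennreal (?P * (exp (- t) * (1 - exp (- t)) ^ (m - 1 + r) / ((m - 1 + r) choose (m - 1))))"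
      by (rule ennreal_mult[symmetric]) (use P t in auto)
    also have "?P * (exp (- t) * (1 - exp (- t)) ^ (m - 1 + r) / ((m - 1 + r) choose (m - 1))) =
        search_prob m (length xs) (search_tree m xs) * (exp (- t) * (1 - exp (- t)) ^ length xs)"
      using search_prob_rec[OF assms(1) xs len] by (simp add: len_eq)
    finally show ?thesis .
  qed
qed

subsection \<open>Independent keys with a continuous distribution\<close>

text \<open>A continuous distribution function means that there are no atoms: given one key, an
  independent second key hits its value with probability zero. Finitely many pairs are excluded
  together.\<close>

lemma AE_inj_on_PiM_continuous:
  fixes D :: "real measure"
  assumes "real_distribution D" and cont: "continuous_on UNIV (cdf D)" and I: "finite I"
  shows "AE x in (\<Pi>\<^sub>M j\<in>I. D). inj_on x I"
proof -
  interpret D: real_distribution D by fact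
  let ?N = "\<Pi>\<^sub>M j\<in>I. D"
  interpret N: prob_space ?N by (intro prob_space_PiM D.prob_space_axioms)
  have null: "emeasure D {a} = 0" for a
    using cont D.isCont_cdf[of a]
    by (simp add: continuous_on_eq_continuous_at D.emeasure_eq_measure)
  have "AE x in ?N. x i \<noteq> x j" if ij: "i \<in> I" "j \<in> I" "i \<noteq> j" for i j
  proof -
    \<comment> \<open>The joint law of the coordinates and the product of their marginals are both
      the product measure itself; that is the criterion for independence.\<close>
    have "distr ?N ?N (\<lambda>x. \<lambda>i\<in>I. x i) = ?N"
      using distr_PiM_reindex[of I "\<lambda>_. D" "\<lambda>i. i" I] D.prob_space_axioms by simp
    moreover have "(\<Pi>\<^sub>M i\<in>I. distr ?N D (\<lambda>x. x i)) = ?N"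
      by (intro PiM_cong refl distr_PiM_component D.prob_space_axioms)
    ultimately have "N.indep_vars (\<lambda>_. D) (\<lambda>i x. x i) I"
      using ij by (subst N.indep_vars_iff_distr_eq_PiM') auto
    then have "N.indep_var (PiM {i} (\<lambda>_. D)) (\<lambda>x. restrict (\<lambda>i. x i) {i})
        (PiM {j} (\<lambda>_. D)) (\<lambda>x. restrict (\<lambda>i. x i) {j})"
      using ij by (intro N.indep_var_restrict) auto
    then have "N.indep_var D ((\<lambda>f. f i) \<circ> (\<lambda>x. restrict (\<lambda>i. x i) {i}))
        D ((\<lambda>f. f j) \<circ> (\<lambda>x. restrict (\<lambda>i. x i) {j}))"
      by (rule N.indep_var_compose) auto
    then have ind: "N.indep_var D (\<lambda>x. x i) D (\<lambda>x. x j)" by (simp add: o_def)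
    have [measurable_cong]: "sets D = sets borel" by simp
    have "emeasure ?N {x \<in> space ?N. x i = x j} =
        (\<integral>\<^sup>+a. emeasure ?N {x \<in> space ?N. a = x j} \<partial>distr ?N D (\<lambda>x. x i))"
      by (rule N.emeasure_indep_pair[OF ind]) measurable
    also have "\<dots> = (\<integral>\<^sup>+a. 0 \<partial>distr ?N D (\<lambda>x. x i))"
    proof (rule nn_integral_cong)
      fix a
      have "emeasure ?N {x \<in> space ?N. a = x j} = emeasure (distr ?N D (\<lambda>x. x j)) {a}"
        using ij by (subst emeasure_distr) (auto intro!: arg_cong2[where f = emeasure])
      also have "\<dots> = 0"
        using ij by (subst distr_PiM_component) (auto simp: null D.prob_space_axioms)
      finally show "emeasure ?N {x \<in> space ?N. a = x j} = 0" .
    qed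
    finally have "emeasure ?N {x \<in> space ?N. x i = x j} = 0" by simp
    moreover have "{x \<in> space ?N. x i = x j} \<in> sets ?N"
      using ij by measurable
    ultimately show ?thesis by (subst AE_iff_measurable) auto
  qed
  then have "AE x in ?N. \<forall>i\<in>I. \<forall>j\<in>I. i \<noteq> j \<longrightarrow> x i \<noteq> x j"
    using I by (intro AE_finite_allI) (auto intro: AE_impI)
  then show ?thesis by eventually_elim (auto simp: inj_on_def)
qed

lemma bij_betw_permutes_permutations_of_set:
  assumes x: "inj_on x {..<n}"
  shows "bij_betw (\<lambda>\<sigma>. map (\<lambda>j. x (\<sigma> j)) [0..<n]) {\<sigma>. \<sigma> permutes {..<n}} (permutations_of_set (x ` {..<n}))"
proof -
  let ?f = "\<lambda>\<sigma>. map (\<lambda>j. x (\<sigma> j)) [0..<n]"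
  have inj: "inj_on ?f {\<sigma>. \<sigma> permutes {..<n}}"
  proof (rule inj_onI)
    fix \<sigma> \<pi> assume p: "\<sigma> \<in> {\<sigma>. \<sigma> permutes {..<n}}" "\<pi> \<in> {\<sigma>. \<sigma> permutes {..<n}}" and eq: "?f \<sigma> = ?f \<pi>"
    show "\<sigma> = \<pi>"
    proof
      fix j show "\<sigma> j = \<pi> j"
      proof (cases "j < n")
        case True
        then have "x (\<sigma> j) = x (\<pi> j)" using eq by auto
        moreover have "\<sigma> j < n" "\<pi> j < n"
          using p True permutes_in_image[of \<sigma> "{..<n}" j] permutes_in_image[of \<pi> "{..<n}" j] by auto
        ultimately show ?thesis using x by (auto dest: inj_onD)
      next
        case False
        then show ?thesis
          using p permutes_not_in[of \<sigma> "{..<n}" j] permutes_not_in[of \<pi> "{..<n}" j] by auto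
      qed
    qed
  qed
  have "?f \<sigma> \<in> permutations_of_set (x ` {..<n})" if \<sigma>: "\<sigma> permutes {..<n}" for \<sigma>
  proof
    have "set (?f \<sigma>) = x ` \<sigma> ` {..<n}" by (auto simp: atLeast0LessThan)
    then show "set (?f \<sigma>) = x ` {..<n}" using permutes_image[OF \<sigma>] by simp
    have "inj_on (x \<circ> \<sigma>) {..<n}"
      using x permutes_inj_on[OF \<sigma>] permutes_image[OF \<sigma>] by (intro comp_inj_on) auto
    then show "distinct (?f \<sigma>)" by (simp add: distinct_map atLeast0LessThan o_def)
  qed
  then have "?f ` {\<sigma>. \<sigma> permutes {..<n}} \<subseteq> permutations_of_set (x ` {..<n})" by blast
  moreover have "card (?f ` {\<sigma>. \<sigma> permutes {..<n}}) = card (permutations_of_set (x ` {..<n}))"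
    using x by (simp add: card_image[OF inj] card_permutations card_image)
  ultimately show ?thesis
    using inj by (simp add: bij_betw_def card_subset_eq)
qed

text \<open>By exchangeability the probability is the average, over all permutations of the sample, of
  an indicator, and this average does not depend on the (almost surely distinct) values.\<close>

lemma emeasure_search_tree_iid:
  fixes D :: "real measure"
  assumes D: "real_distribution D" and cont: "continuous_on UNIV (cdf D)"
  shows "emeasure (\<Pi>\<^sub>M j\<in>{..<n}. D) {x \<in> space (\<Pi>\<^sub>M j\<in>{..<n}. D). search_tree m (map x [0..<n]) = T} =
    ennreal (search_prob m n T)"
proof -
  interpret D: real_distribution D by fact
  let ?N = "\<Pi>\<^sub>M j\<in>{..<n}. D"
  let ?P = "{\<sigma> :: nat \<Rightarrow> nat. \<sigma> permutes {..<n}}"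
  let ?tree = "\<lambda>\<sigma> x. search_tree m (map (\<lambda>j. x (\<sigma> j)) [0..<n])"
  let ?E = "\<lambda>\<sigma>. {x \<in> space ?N. ?tree \<sigma> x = T}"
  interpret N: prob_space ?N by (intro prob_space_PiM D.prob_space_axioms)
  have reindex: "(\<lambda>x. \<lambda>j\<in>{..<n}. x (\<sigma> j)) \<in> measurable ?N ?N"
    and distr: "distr ?N ?N (\<lambda>x. \<lambda>j\<in>{..<n}. x (\<sigma> j)) = ?N" if "\<sigma> \<in> ?P" for \<sigma>
  proof -
    have \<sigma>: "\<sigma> ` {..<n} = {..<n}" "inj_on \<sigma> {..<n}"
      using that permutes_image permutes_inj_on by auto
    then show "(\<lambda>x. \<lambda>j\<in>{..<n}. x (\<sigma> j)) \<in> measurable ?N ?N"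
      by (intro measurable_restrict measurable_component_singleton) auto
    show "distr ?N ?N (\<lambda>x. \<lambda>j\<in>{..<n}. x (\<sigma> j)) = ?N"
      using \<sigma> by (intro distr_PiM_reindex[of "{..<n}" "\<lambda>_. D" \<sigma> "{..<n}"]) (auto simp: D.prob_space_axioms)
  qed
  have base: "{x \<in> space ?N. search_tree m (map x [0..<n]) = T} \<in> sets ?N" (is "?B \<in> _")
    using pred_eq_tree[OF search_tree_measurable[OF D]] by (simp add: pred_def)
  have tree_restrict: "search_tree m (map (\<lambda>j\<in>{..<n}. x (\<sigma> j)) [0..<n]) = ?tree \<sigma> x" for x \<sigma>
    by (intro arg_cong[where f = "search_tree m"] map_cong) auto
  have vimage: "(\<lambda>x. \<lambda>j\<in>{..<n}. x (\<sigma> j)) -` ?B \<inter> space ?N = ?E \<sigma>" if "\<sigma> \<in> ?P" for \<sigma>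
    using measurable_space[OF reindex[OF that]] by (auto simp only: tree_restrict vimage_eq mem_Collect_eq Int_iff)
  have E: "?E \<sigma> \<in> sets ?N" "emeasure ?N (?E \<sigma>) = emeasure ?N ?B" if "\<sigma> \<in> ?P" for \<sigma>
  proof -
    show "?E \<sigma> \<in> sets ?N"
      using measurable_sets[OF reindex[OF that] base] vimage[OF that] by simp
    have "emeasure ?N ?B = emeasure (distr ?N ?N (\<lambda>x. \<lambda>j\<in>{..<n}. x (\<sigma> j))) ?B"
      using distr[OF that] by simp
    also have "\<dots> = emeasure ?N (?E \<sigma>)"
      unfolding emeasure_distr[OF reindex[OF that] base] vimage[OF that] ..
    finally show "emeasure ?N (?E \<sigma>) = emeasure ?N ?B" ..
  qed
  have finP: "finite ?P" by (rule finite_permutations) simp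
  have cardP: "card ?P = fact n" by (rule card_permutations) auto
  have "of_nat (fact n) * emeasure ?N ?B = (\<Sum>\<sigma>\<in>?P. emeasure ?N (?E \<sigma>))"
    using E(2) by (simp add: cardP)
  also have "\<dots> = (\<Sum>\<sigma>\<in>?P. \<integral>\<^sup>+x. indicator (?E \<sigma>) x \<partial>?N)"
    using E(1) by (intro sum.cong refl nn_integral_indicator[symmetric])
  also have "\<dots> = (\<integral>\<^sup>+x. (\<Sum>\<sigma>\<in>?P. indicator (?E \<sigma>) x) \<partial>?N)"
    using E(1) by (intro nn_integral_sum[symmetric] borel_measurable_indicator)
  also have "\<dots> = (\<integral>\<^sup>+x. ennreal (fact n * search_prob m n T) \<partial>?N)"
  proof (rule nn_integral_cong_AE)
    show "AE x in ?N. (\<Sum>\<sigma>\<in>?P. indicator (?E \<sigma>) x) = ennreal (fact n * search_prob m n T)"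
      using AE_inj_on_PiM_continuous[OF D cont finite_lessThan[of n]] AE_space
    proof eventually_elim
      case (elim x)
      have "(\<Sum>\<sigma>\<in>?P. indicator (?E \<sigma>) x) = (\<Sum>\<sigma>\<in>?P. if ?tree \<sigma> x = T then 1 else 0 :: ennreal)"
        using elim(2) by (intro sum.cong) auto
      also have "\<dots> = of_nat (card {\<sigma> \<in> ?P. ?tree \<sigma> x = T})"
        using finP by (simp add: sum.If_cases Int_def)
      \<comment> \<open>For distinct values, reordering indices is the same as reordering values,
        and the latter count depends only on the number of values.\<close>
      also have "card {\<sigma> \<in> ?P. ?tree \<sigma> x = T} =
          card {xs \<in> permutations_of_set (x ` {..<n}). search_tree m xs = T}"
      proof (rule bij_betw_same_card)
        have bij: "bij_betw (\<lambda>\<sigma>. map (\<lambda>j. x (\<sigma> j)) [0..<n]) ?P (permutations_of_set (x ` {..<n}))"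
          by (rule bij_betw_permutes_permutations_of_set[OF elim(1)])
        show "bij_betw (\<lambda>\<sigma>. map (\<lambda>j. x (\<sigma> j)) [0..<n]) {\<sigma> \<in> ?P. ?tree \<sigma> x = T}
            {xs \<in> permutations_of_set (x ` {..<n}). search_tree m xs = T}"
          by (rule bij_betw_Collect[OF bij]) blast
      qed
      also have "of_nat \<dots> = ennreal (fact n * search_prob m n T)"
      proof -
        have "card (x ` {..<n}) = n" using elim(1) by (simp add: card_image)
        then have "search_prob m n T =
            card {xs \<in> permutations_of_set (x ` {..<n}). search_tree m xs = T} / fact n"
          using search_prob_altdef[of "x ` {..<n}" m T] by (simp only: finite_imageI finite_lessThan)
        then have "fact n * search_prob m n T =
            real (card {xs \<in> permutations_of_set (x ` {..<n}). search_tree m xs = T})"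
          by (simp only: times_divide_eq_right nonzero_mult_div_cancel_left fact_nonzero not_False_eq_True)
        then show ?thesis by (simp only: ennreal_of_nat_eq_real_of_nat)
      qed
      finally show ?case .
    qed
  qed
  also have "\<dots> = ennreal (fact n * search_prob m n T)"
    by (simp add: N.emeasure_space_1)
  also have "\<dots> = of_nat (fact n) * ennreal (search_prob m n T)"
    by (simp add: ennreal_mult search_prob_nonneg ennreal_of_nat_eq_real_of_nat)
  finally show ?thesis
    by (subst (asm) ennreal_mult_cancel_left) (auto simp: ennreal_of_nat_eq_real_of_nat)
qed

text \<open>Absent nodes contribute 0, which allows a sum over all addresses; with nonnegative terms
  it is a supremum of finite sums over countably many finite sets.\<close>

lemma num_keys_measurable: "num_keys \<in> borel_measurable tree_space"
proof -
  let ?g = "\<lambda>T u. case T u of None \<Rightarrow> 0 | Some j \<Rightarrow> (of_nat j :: ennreal)"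
  have "num_keys T = (SUP F\<in>{F. finite F \<and> F \<subseteq> UNIV}. \<Sum>u\<in>F. ?g T u)" for T
  proof -
    have "num_keys T = infsum (?g T) UNIV"
      unfolding num_keys_def by (intro infsum_cong_neutral) (auto split: option.split)
    also have "\<dots> = (SUP F\<in>{F. finite F \<and> F \<subseteq> UNIV}. \<Sum>u\<in>F. ?g T u)"
      by (rule nonneg_infsum_complete) simp
    finally show ?thesis .
  qed
  moreover have "(\<lambda>T. SUP F\<in>{F. finite F \<and> F \<subseteq> UNIV}. \<Sum>u\<in>F. ?g T u) \<in> borel_measurable tree_space"
  proof (intro borel_measurable_SUP borel_measurable_sum)
    show "countable {F. finite F \<and> F \<subseteq> (UNIV :: nat list set)}"
      by (intro countable_Collect_finite_subset) auto
    fix u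
    have "(\<lambda>T. T u) \<in> measurable tree_space (count_space UNIV)"
      unfolding tree_space_def by (intro measurable_component_singleton) auto
    then show "(\<lambda>T. ?g T u) \<in> borel_measurable tree_space"
      by (rule measurable_compose) simp
  qed
  ultimately show ?thesis by (simp cong: measurable_cong)
qed

text \<open>Adding up singletons gives \<open>N\<close> mass 1 on \<open>A\<close> as well, so both
  measures ignore everything outside \<open>A\<close>. It suits the conditioned fringe tree, about
  whose behaviour outside the search trees nothing is known directly.\<close>

lemma measure_eqI_finite_carrier:
  assumes "prob_space M" "prob_space N" "sets M = sets N" "finite A"
    and A: "\<And>a. a \<in> A \<Longrightarrow> {a} \<in> sets M" "\<And>a. a \<in> A \<Longrightarrow> emeasure M {a} = emeasure N {a}"
    and "emeasure M A = 1"
  shows "M = N"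
proof (rule measure_eqI)
  have sing: "emeasure M B = emeasure N B" if "B \<subseteq> A" for B
    using that A assms(3,4) finite_subset[OF that]
    by (subst (1 2) emeasure_eq_sum_singleton) (auto intro!: sum.cong)
  have A_sets: "A \<in> sets M"
    using sets.countable[OF A(1) countable_finite[OF assms(4)]] by simp
  have null: "emeasure L (B - A) = 0"
    if "prob_space L" "sets L = sets M" "emeasure L A = 1" "B \<in> sets M" for L B
  proof -
    interpret L: prob_space L by fact
    have "emeasure L (B - A) \<le> emeasure L (space L - A)"
      using that A_sets sets.sets_into_space[of B L] by (intro emeasure_mono) auto
    also have "\<dots> = 0"
      using that A_sets by (subst emeasure_compl) (auto simp: L.emeasure_space_1)
    finally show ?thesis by simp
  qed
  fix B assume B: "B \<in> sets M"
  have "emeasure L B = emeasure L (B \<inter> A) + emeasure L (B - A)" if "sets L = sets M" for L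
    using B A_sets that by (subst plus_emeasure) (auto intro!: arg_cong2[where f = emeasure])
  then show "emeasure M B = emeasure N B"
    using null[of M B] null[of N B] B assms sing[of A] sing[of "B \<inter> A"] by simp
qed fact

subsection \<open>The fringe tree\<close>

lemma stopped_branching_process_life_histories:
  assumes "stopped_branching_process M m Y \<tau>"
  shows "life_histories M m Y"
proof -
  interpret prob_space M using assms by (simp add: stopped_branching_process_def)
  let ?X = "\<lambda>a. case a of None \<Rightarrow> \<tau> | Some (u, i) \<Rightarrow> Y u i"
  have "indep_vars (\<lambda>_. borel) (\<lambda>p. ?X (Some p)) (lists {1..m} \<times> {1..m-1})"
    using assms
    by (intro indep_vars_reindex[where X = ?X and N = "\<lambda>_. borel" and h = Some
        and I = "insert None (Some ` (lists {1..m} \<times> {1..m-1}))"])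
      (auto simp: stopped_branching_process_def)
  then show ?thesis
    using assms by (simp add: life_histories_def stopped_branching_process_def case_prod_beta)
qed

lemma emeasure_fringe_tree_eq_search_tree:
  assumes m: "m \<ge> 2" and S: "stopped_branching_process M m Y \<tau>" and xs: "distinct xs"
  shows "emeasure M {\<omega> \<in> space M. fringe_tree m Y \<tau> \<omega> = search_tree m xs} =
    ennreal (search_prob m (length xs) (search_tree m xs) / ((real (length xs) + 1) * (real (length xs) + 2)))"
proof -
  interpret prob_space M using S by (simp add: stopped_branching_process_def)
  let ?X = "\<lambda>a. case a of None \<Rightarrow> \<tau> | Some (u, i) \<Rightarrow> Y u i"
  let ?B = "Some ` (lists {1..m} \<times> {1..m-1})"
  let ?Z = "\<lambda>\<omega>. restrict (\<lambda>a. ?X a \<omega>) ?B"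
  let ?k = "length xs" and ?T = "search_tree m xs"
  let ?Q = "\<lambda>t (z :: (nat list \<times> nat) option \<Rightarrow> real). family_tree m (\<lambda>u i. z (Some (u, i))) t = ?T"
  have Y: "life_histories M m Y" by (rule stopped_branching_process_life_histories[OF S])
  have \<tau>: "distributed M lborel \<tau> (exponential_density 1)"
    using S by (simp add: stopped_branching_process_def)
  have ind: "indep_var (PiM {None} (\<lambda>_. borel)) (\<lambda>\<omega>. restrict (\<lambda>a. ?X a \<omega>) {None}) (PiM ?B (\<lambda>_. borel)) ?Z"
    using S by (intro indep_var_restrict) (auto simp: stopped_branching_process_def)
  have Q: "Measurable.pred (borel \<Otimes>\<^sub>M PiM ?B (\<lambda>_. borel)) (\<lambda>p. ?Q (fst p) (snd p))"
  proof (intro pred_eq_tree measurable_family_tree)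
    fix u i assume "u \<in> lists {1..m}" "i \<in> {1..m-1}"
    then have [measurable]: "(\<lambda>z. z (Some (u, i))) \<in> borel_measurable (PiM ?B (\<lambda>_. borel :: real measure))"
      by (intro measurable_component_singleton) auto
    show "(\<lambda>p. snd p (Some (u, i))) \<in> borel_measurable (borel \<Otimes>\<^sub>M PiM ?B (\<lambda>_. borel :: real measure))"
      by measurable
  qed measurable
  have restrict: "family_tree m (\<lambda>u i. ?Z \<omega> (Some (u, i))) t = family_tree m (\<lambda>u i. Y u i \<omega>) t" for \<omega> t
    by (intro family_tree_cong) auto
  have "emeasure M {\<omega> \<in> space M. fringe_tree m Y \<tau> \<omega> = ?T} =
      emeasure M {\<omega> \<in> space M. ?Q ((\<lambda>f. f None) (restrict (\<lambda>a. ?X a \<omega>) {None})) (?Z \<omega>)}"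
    unfolding restrict by (simp add: fringe_tree_def)
  also have "\<dots> = (\<integral>\<^sup>+t. exponential_density 1 t * emeasure M {\<omega> \<in> space M. ?Q t (?Z \<omega>)} \<partial>lborel)"
    by (rule emeasure_indep_distributed[OF ind, where Q = ?Q]) (use \<tau> Q in auto)
  also have "\<dots> = (\<integral>\<^sup>+t. ennreal (search_prob m ?k ?T) *
      ennreal (exponential_density 1 t * (exp (- t) * (1 - exp (- t)) ^ ?k)) \<partial>lborel)"
  proof (rule nn_integral_cong)
    fix t :: real
    show "ennreal (exponential_density 1 t) * emeasure M {\<omega> \<in> space M. ?Q t (?Z \<omega>)} =
      ennreal (search_prob m ?k ?T) * ennreal (exponential_density 1 t * (exp (- t) * (1 - exp (- t)) ^ ?k))"
    proof (cases "t \<ge> 0")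
      case True
      show ?thesis
        unfolding restrict emeasure_family_tree_eq_search_tree[OF m Y xs True]
        using True
        by (simp add: ennreal_mult[symmetric] search_prob_nonneg exponential_density_nonneg mult_ac)
    next
      case False
      then show ?thesis by (simp add: exponential_density_def)
    qed
  qed
  also have "\<dots> = ennreal (search_prob m ?k ?T) * ennreal (1 / ((real ?k + 1) * (real ?k + 2)))"
    by (subst nn_integral_cmult) (simp_all only: nn_integral_exponential_yule, measurable)
  also have "\<dots> = ennreal (search_prob m ?k ?T / ((real ?k + 1) * (real ?k + 2)))"
    by (subst ennreal_mult[symmetric]) (auto simp: search_prob_nonneg)
  finally show ?thesis .
qed

lemma sums_inverse_consecutive: "(\<lambda>k. 1 / ((real k + 1) * (real k + 2))) sums 1"
proof -
  have "(\<lambda>k. 1 / (real k + 1)) \<longlonglongrightarrow> 0"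
    using LIMSEQ_inverse_real_of_nat by (simp add: inverse_eq_divide add.commute)
  from telescope_sums'[OF this] show ?thesis
    by (simp add: field_simps)
qed

lemma sum_search_prob:
  "(\<Sum>T\<in>search_tree m ` permutations_of_set (real ` {..<k}). search_prob m k T) = 1"
proof -
  let ?P = "permutations_of_set (real ` {..<k})"
  have "(\<Sum>T\<in>search_tree m ` ?P. card {xs \<in> ?P. search_tree m xs = T}) = card ?P"
    using sum.image_gen[of ?P "\<lambda>_. 1 :: nat" "search_tree m"] by (simp only: card_eq_sum finite_permutations_of_set)
  also have "\<dots> = fact k" by (simp add: card_image)
  finally have "real (\<Sum>T\<in>search_tree m ` ?P. card {xs \<in> ?P. search_tree m xs = T}) = real (fact k)"
    by (rule arg_cong)
  then show ?thesis
    unfolding search_prob_def sum_divide_distrib[symmetric] of_nat_sum of_nat_fact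
    by (simp only: divide_self fact_nonzero not_False_eq_True)
qed

theorem theorem7p3:
  fixes m :: nat and M :: "'a measure"
    and Y :: "nat list \<Rightarrow> nat \<Rightarrow> 'a \<Rightarrow> real" and \<tau> :: "'a \<Rightarrow> real"
    and D :: "real measure"
  assumes "m \<ge> 2"
    and "stopped_branching_process M m Y \<tau>"
    and "real_distribution D" and "continuous_on UNIV (cdf D)"
  shows "(\<forall>k::nat. measure M {\<omega> \<in> space M. num_keys (fringe_tree m Y \<tau> \<omega>) = of_nat k}
             = 1 / ((real k + 1) * (real k + 2)))
    \<and> (\<forall>k::nat. distr (uniform_measure M {\<omega> \<in> space M. num_keys (fringe_tree m Y \<tau> \<omega>) = of_nat k})
                  tree_space (fringe_tree m Y \<tau>)
             = random_search_tree m D k)"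
proof -
  interpret prob_space M using assms(2) by (simp add: stopped_branching_process_def)
  interpret D: real_distribution D by fact
  let ?F = "fringe_tree m Y \<tau>"
  let ?E = "\<lambda>k. {\<omega> \<in> space M. num_keys (?F \<omega>) = of_nat k}"
  let ?A = "\<lambda>k. search_tree m ` permutations_of_set (real ` {..<k})"
  let ?w = "\<lambda>k. 1 / ((real k + 1) * (real k + 2))"
  have F: "?F \<in> measurable M tree_space" by (rule fringe_tree_measurable) fact
  have E: "?E k \<in> sets M" for k
    using borel_measurable_eq[OF measurable_compose[OF F num_keys_measurable] borel_measurable_const]
    by simp
  have F_eq: "{\<omega> \<in> space M. ?F \<omega> = T} \<in> sets M" for T
    using pred_eq_tree[OF F] by (simp add: pred_def)
  have A: "num_keys T = of_nat k" "prob {\<omega> \<in> space M. ?F \<omega> = T} = search_prob m k T * ?w k"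
    if T: "T \<in> ?A k" for T k
  proof -
    obtain xs where xs: "xs \<in> permutations_of_set (real ` {..<k})" "T = search_tree m xs"
      using T by blast
    have len: "length xs = k" using length_finite_permutations_of_set[OF xs(1)] by (simp add: card_image)
    show "num_keys T = of_nat k" using num_keys_search_tree[OF assms(1)] xs(2) len by simp
    have "emeasure M {\<omega> \<in> space M. ?F \<omega> = T} = ennreal (search_prob m k T * ?w k)"
      using emeasure_fringe_tree_eq_search_tree[OF assms(1,2) permutations_of_setD(2)[OF xs(1)]]
      unfolding xs(2) len by simp
    then show "prob {\<omega> \<in> space M. ?F \<omega> = T} = search_prob m k T * ?w k"
      using search_prob_nonneg[of m k T] by (simp add: emeasure_eq_measure)
  qed
  \<comment> \<open>Only an inequality for now: trees with \<open>k\<close> keys that are not search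
    trees have not been excluded.\<close>
  have E_ge: "?w k \<le> prob (?E k)" for k
  proof -
    have "?w k = (\<Sum>T\<in>?A k. prob {\<omega> \<in> space M. ?F \<omega> = T})"
      using A(2)[of _ k] sum_search_prob[of m k] by (simp add: sum_divide_distrib[symmetric])
    also have "\<dots> = prob (\<Union>T\<in>?A k. {\<omega> \<in> space M. ?F \<omega> = T})"
      using F_eq by (intro finite_measure_finite_Union[symmetric]) (auto simp: disjoint_family_on_def)
    also have "\<dots> \<le> prob (?E k)"
      using A(1) E by (intro finite_measure_mono) auto
    finally show ?thesis .
  qed
  have E_eq: "prob (?E k) = ?w k" for k
  proof -
    have "(\<lambda>k. prob (?E k)) sums prob (\<Union>k. ?E k)"
      using E by (intro finite_measure_UNION) (auto simp: disjoint_family_on_def)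
    \<comment> \<open>The excesses over the expected values are nonnegative, but their sum is a
      probability minus 1, hence at most 0. So every single excess vanishes.\<close>
    then have sums: "(\<lambda>k. prob (?E k) - ?w k) sums (prob (\<Union>k. ?E k) - 1)"
      by (rule sums_diff[OF _ sums_inverse_consecutive])
    have "prob (?E k) - ?w k = (\<Sum>j\<in>{k}. prob (?E j) - ?w j)" by simp
    also have "\<dots> \<le> (\<Sum>j. prob (?E j) - ?w j)"
      using E_ge by (intro sum_le_suminf sums_summable[OF sums]) auto
    also have "\<dots> = prob (\<Union>k. ?E k) - 1" by (rule sums_unique[OF sums, symmetric])
    also have "\<dots> \<le> 0" by simp
    finally show ?thesis using E_ge[of k] by simp
  qed
  have "distr (uniform_measure M (?E k)) tree_space ?F = random_search_tree m D k" for k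
  proof (rule measure_eqI_finite_carrier[where A = "?A k"])
    have w_pos: "?w k > 0" by simp
    let ?N = "\<Pi>\<^sub>M j\<in>{..<k}. D"
    have F': "?F \<in> measurable (uniform_measure M (?E k)) tree_space" using F by simp
    have tree: "(\<lambda>x. search_tree m (map x [0..<k])) \<in> measurable ?N tree_space"
      by (rule search_tree_measurable) fact
    show "prob_space (distr (uniform_measure M (?E k)) tree_space ?F)"
      using w_pos E_eq[of k]
      by (intro prob_space.prob_space_distr[OF _ F'] prob_space_uniform_measure)
        (auto simp: emeasure_eq_measure)
    interpret N: prob_space ?N by (intro prob_space_PiM D.prob_space_axioms)
    show "prob_space (random_search_tree m D k)"
      unfolding random_search_tree_def by (rule N.prob_space_distr[OF tree])
    show "sets (distr (uniform_measure M (?E k)) tree_space ?F) = sets (random_search_tree m D k)"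
      by (simp add: random_search_tree_def)
    show "finite (?A k)" by simp
    show "{T} \<in> sets (distr (uniform_measure M (?E k)) tree_space ?F)" for T
      by simp
    have single: "emeasure (distr (uniform_measure M (?E k)) tree_space ?F) {T} = ennreal (search_prob m k T)"
      if T: "T \<in> ?A k" for T
    proof -
      have "emeasure (distr (uniform_measure M (?E k)) tree_space ?F) {T} =
          emeasure (uniform_measure M (?E k)) {\<omega> \<in> space M. ?F \<omega> = T}"
        by (subst emeasure_distr[OF F']) (auto intro!: arg_cong2[where f = emeasure])
      also have "\<dots> = emeasure M (?E k \<inter> {\<omega> \<in> space M. ?F \<omega> = T}) / emeasure M (?E k)"
        using E F_eq by (rule emeasure_uniform_measure)
      \<comment> \<open>A search tree in \<open>?A k\<close> has \<open>k\<close> keys, so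
        conditioning only divides its probability by that of \<open>?E k\<close>; the factor
        \<open>?w k\<close> cancels.\<close>
      also have "?E k \<inter> {\<omega> \<in> space M. ?F \<omega> = T} = {\<omega> \<in> space M. ?F \<omega> = T}"
        using A(1)[OF T] by auto
      also have "emeasure M {\<omega> \<in> space M. ?F \<omega> = T} / emeasure M (?E k) = ennreal (search_prob m k T)"
        unfolding emeasure_eq_measure E_eq A(2)[OF T]
        using w_pos by (subst divide_ennreal) (auto simp: search_prob_nonneg)
      finally show ?thesis .
    qed
    show "emeasure (distr (uniform_measure M (?E k)) tree_space ?F) {T} =
        emeasure (random_search_tree m D k) {T}" if T: "T \<in> ?A k" for T
    proof -
      have "emeasure (random_search_tree m D k) {T} =
          emeasure ?N {x \<in> space ?N. search_tree m (map x [0..<k]) = T}"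
        unfolding random_search_tree_def
        by (subst emeasure_distr[OF tree]) (auto intro!: arg_cong2[where f = emeasure])
      then show ?thesis
        using emeasure_search_tree_iid[OF assms(3,4), of k m T] single[OF T] by simp
    qed
    \<comment> \<open>The conditional probabilities of the search trees with \<open>k\<close> keys
      already sum to 1, which rules out all other trees.\<close>
    show "emeasure (distr (uniform_measure M (?E k)) tree_space ?F) (?A k) = 1"
      using single sum_search_prob[of m k]
      by (subst emeasure_eq_sum_singleton) (auto simp: sum_ennreal search_prob_nonneg)
  qed
  with E_eq show ?thesis by blast
qed

end
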